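(* Let $(V_4,g)$ be a $4$-dimensional spacetime satisfying the Einstein field equations $R_{ab}-\frac12 R g_{ab}=k\,T_{ab}$ with perfect fluid energy-momentum tensor $T_{ab}=(\mu+p)u_au_b+p\,g_{ab}$, and suppose that the $W$-curvature tensor is conserved, i.e. $\nabla_hW^h{}_{bcd}=0$. Then $V_4$ is either an Einstein spacetime with $\mu+p=0$, or a Friedmann-Robertson-Walker cosmological model satisfying $\mu-3p=\text{constant}$.
   Context: A spacetime $V_4$ is a $4$-dimensional Lorentzian manifold with metric $g_{ab}$ of signature $(-,+,+,+)$ and Levi-Civita connection $\nabla$. The Riemann tensor is $R(X,Y,Z,T)=g(\nabla_X\nabla_YZ-\nabla_Y\nabla_XZ-\nabla_{[X,Y]}Z,T)$, with components $R_{abcd}$; the Ricci tensor is $R_{bc}=g^{ad}R_{abcd}$ and the scalar curvature is $R=g^{bc}R_{bc}$. The $W$-curvature tensor is $W_{abcd}=R_{abcd}+\frac13\left[g_{ac}R_{bd}-g_{bc}R_{ad}\right]$, and $W^h{}_{bcd}=g^{ha}W_{abcd}$; it is called conserved (divergence-free) if $\nabla_hW^h{}_{bcd}=0$. $k$ is the non-zero gravitational constant. The energy density $\mu$ and isotropic pressure $p$ are scalar functions and $u^a$ is the fluid velocity, with $u_a=g_{ab}u^b$, $u_au^a=-1$. An Einstein spacetime is one with $R_{ab}=\frac R4 g_{ab}$. Put $h_{ab}=g_{ab}+u_au_b$, expansion $\theta=\nabla_au^a$, acceleration $\dot u_a=u^b\nabla_bu_a$, shear $\sigma_{ab}=h_a^ch_b^d\nabla_{(d}u_{c)}-\frac13\theta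 h_{ab}$, and rotation $\omega_{ab}=h_a^ch_b^d\nabla_{[d}u_{c]}$, so that $\nabla_bu_a=\frac13\theta h_{ab}-\dot u_au_b+\sigma_{ab}+\omega_{ab}$. A perfect fluid spacetime is regarded as a Friedmann-Robertson-Walker cosmological model when $\mu+p\neq0$, $\dot u_a=0$, $\sigma_{ab}=0$, $\omega_{ab}=0$, and $\mu$ and $p$ are constant over the spacelike hypersurfaces orthogonal to $u^a$ (i.e. $h_a^b\nabla_b\mu=0=h_a^b\nabla_bp$).
   Formalization: The spacetime is assumed connected, as is customary; without this the global alternative fails (a disjoint union of de Sitter space and the Einstein static universe satisfies every hypothesis but neither conclusion). *)

theory Defs
  imports "HOL-Analysis.Analysis"
begin

section \<open>Smooth manifolds\<close>

primrec Ck_on :: "nat \<Rightarrow> (real^'n::finite) set \<Rightarrow> (real^'n \<Rightarrow> real) \<Rightarrow> bool" where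
  "Ck_on 0 S f \<longleftrightarrow> continuous_on S f"
| "Ck_on (Suc m) S f \<longleftrightarrow>
     (\<forall>x\<in>S. f differentiable (at x)) \<and>
     (\<forall>i. Ck_on m S (\<lambda>x. frechet_derivative f (at x) (axis i 1)))"

definition smooth_on :: "(real^'n::finite) set \<Rightarrow> (real^'n \<Rightarrow> real) \<Rightarrow> bool" where
  "smooth_on S f \<longleftrightarrow> (\<forall>m. Ck_on m S f)"

text \<open>
  A chart is a pair of its domain and its coordinate map; the values of the coordinate map outside
  the domain are irrelevant.  The manifold is the whole type \<open>'m\<close>.
\<close>

type_synonym ('m, 'n) chart = "'m set \<times> ('m \<Rightarrow> real^'n)"

abbreviation chart_dom :: "('m, 'n::finite) chart \<Rightarrow> 'm set" where
  "chart_dom \<phi> \<equiv> fst \<phi>"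

abbreviation chart_map :: "('m, 'n::finite) chart \<Rightarrow> 'm \<Rightarrow> real^'n" where
  "chart_map \<phi> \<equiv> snd \<phi>"

definition chart_inv :: "('m, 'n::finite) chart \<Rightarrow> real^'n \<Rightarrow> 'm" where
  "chart_inv \<phi> = inv_into (chart_dom \<phi>) (chart_map \<phi>)"

definition is_chart :: "('m::topological_space, 'n::finite) chart \<Rightarrow> bool" where
  "is_chart \<phi> \<longleftrightarrow> open (chart_dom \<phi>) \<and> open (chart_map \<phi> ` chart_dom \<phi>) \<and>
     homeomorphism (chart_dom \<phi>) (chart_map \<phi> ` chart_dom \<phi>) (chart_map \<phi>) (chart_inv \<phi>)"

definition smooth_atlas :: "('m::topological_space, 'n::finite) chart set \<Rightarrow> bool" where
  "smooth_atlas A \<longleftrightarrow>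
     (\<forall>\<phi>\<in>A. is_chart \<phi>) \<and> (\<Union>\<phi>\<in>A. chart_dom \<phi>) = UNIV \<and>
     (\<forall>\<phi>\<in>A. \<forall>\<psi>\<in>A. \<forall>i. smooth_on (chart_map \<phi> ` (chart_dom \<phi> \<inter> chart_dom \<psi>))
                           (\<lambda>z. chart_map \<psi> (chart_inv \<phi> z) $ i))"

text \<open>The derivative of a function on the manifold along the \<open>i\<close>-th coordinate of \<open>\<phi>\<close>.\<close>

definition partial :: "('m, 'n::finite) chart \<Rightarrow> 'n \<Rightarrow> ('m \<Rightarrow> real) \<Rightarrow> 'm \<Rightarrow> real" where
  "partial \<phi> i f x =
     frechet_derivative (f \<circ> chart_inv \<phi>) (at (chart_map \<phi> x)) (axis i 1)"

definition smooth_in_chart :: "('m, 'n::finite) chart \<Rightarrow> ('m \<Rightarrow> real) \<Rightarrow> bool" where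
  "smooth_in_chart \<phi> f \<longleftrightarrow> smooth_on (chart_map \<phi> ` chart_dom \<phi>) (f \<circ> chart_inv \<phi>)"

definition scalar_field :: "('m, 'n::finite) chart set \<Rightarrow> ('m \<Rightarrow> real) \<Rightarrow> bool" where
  "scalar_field A f \<longleftrightarrow> (\<forall>\<phi>\<in>A. smooth_in_chart \<phi> f)"

text \<open>
  \<open>jac \<phi> \<psi> x\<close> has the entries \<open>\<partial>\<psi>\<^sup>i/\<partial>\<phi>\<^sup>j\<close>.  Tensor fields are given by
  their components in every chart of the atlas, subject to the classical transformation law.
  The components are functions of the point of the manifold, and only their values on the chart
  domain matter.
\<close>

definition jac :: "('m, 'n::finite) chart \<Rightarrow> ('m, 'n) chart \<Rightarrow> 'm \<Rightarrow> real^'n^'n" where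
  "jac \<phi> \<psi> x = (\<chi> i j. partial \<phi> j (\<lambda>y. chart_map \<psi> y $ i) x)"

definition vector_field ::
    "('m, 'n::finite) chart set \<Rightarrow> (('m, 'n) chart \<Rightarrow> 'm \<Rightarrow> real^'n) \<Rightarrow> bool" where
  "vector_field A u \<longleftrightarrow>
     (\<forall>\<phi>\<in>A. \<forall>i. smooth_in_chart \<phi> (\<lambda>x. u \<phi> x $ i)) \<and>
     (\<forall>\<phi>\<in>A. \<forall>\<psi>\<in>A. \<forall>x\<in>chart_dom \<phi> \<inter> chart_dom \<psi>. u \<psi> x = jac \<phi> \<psi> x *v u \<phi> x)"

definition bilinear_form_field ::
    "('m, 'n::finite) chart set \<Rightarrow> (('m, 'n) chart \<Rightarrow> 'm \<Rightarrow> real^'n^'n) \<Rightarrow> bool" where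
  "bilinear_form_field A g \<longleftrightarrow>
     (\<forall>\<phi>\<in>A. \<forall>i j. smooth_in_chart \<phi> (\<lambda>x. g \<phi> x $ i $ j)) \<and>
     (\<forall>\<phi>\<in>A. \<forall>\<psi>\<in>A. \<forall>x\<in>chart_dom \<phi> \<inter> chart_dom \<psi>.
        g \<phi> x = transpose (jac \<phi> \<psi> x) ** g \<psi> x ** jac \<phi> \<psi> x)"

section \<open>Lorentzian metrics\<close>

definition minkowski :: "real^4^4" where
  "minkowski = (\<chi> i j. if i \<noteq> j then 0 else if i = 0 then -1 else 1)"

definition lorentz_form :: "real^4^4 \<Rightarrow> bool" where
  "lorentz_form B \<longleftrightarrow>
     transpose B = B \<and> (\<exists>P. invertible P \<and> transpose P ** B ** P = minkowski)"

definition lorentz_metric ::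
    "('m, 4) chart set \<Rightarrow> (('m, 4) chart \<Rightarrow> 'm \<Rightarrow> real^4^4) \<Rightarrow> bool" where
  "lorentz_metric A g \<longleftrightarrow>
     bilinear_form_field A g \<and> (\<forall>\<phi>\<in>A. \<forall>x\<in>chart_dom \<phi>. lorentz_form (g \<phi> x))"

text \<open>Spacetimes are connected, as usual.\<close>

definition spacetime ::
    "('m::{t2_space, second_countable_topology}, 4) chart set \<Rightarrow>
     (('m, 4) chart \<Rightarrow> 'm \<Rightarrow> real^4^4) \<Rightarrow> bool" where
  "spacetime A g \<longleftrightarrow> smooth_atlas A \<and> connected (UNIV :: 'm set) \<and> lorentz_metric A g"

section \<open>Levi-Civita connection and curvature in a chart\<close>

text \<open>
  In this section \<open>g\<close> stands for the components of the metric in the single chart \<open>\<phi>\<close>, and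
  \<open>X\<close>, \<open>Y\<close>, \<open>Z\<close>, \<open>T\<close> for the components of vector fields in that chart.
\<close>

definition ginv :: "('m \<Rightarrow> real^'n^'n::finite) \<Rightarrow> 'n \<Rightarrow> 'n \<Rightarrow> 'm \<Rightarrow> real" where
  "ginv g a b x = matrix_inv (g x) $ a $ b"

text \<open>\<open>christoffel \<phi> g i j k\<close> is \<open>\<Gamma>\<^sup>i\<^bsub>jk\<^esub>\<close>, that is, \<open>\<nabla>\<^bsub>\<partial>j\<^esub> \<partial>\<^sub>k = \<Sum>i. \<Gamma>\<^sup>i\<^bsub>jk\<^esub> \<partial>\<^sub>i\<close>.\<close>

definition christoffel ::
    "('m, 'n::finite) chart \<Rightarrow> ('m \<Rightarrow> real^'n^'n) \<Rightarrow> 'n \<Rightarrow> 'n \<Rightarrow> 'n \<Rightarrow> 'm \<Rightarrow> real" where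
  "christoffel \<phi> g i j k x =
     (\<Sum>l\<in>UNIV. ginv g i l x *
        (partial \<phi> j (\<lambda>y. g y $ l $ k) x + partial \<phi> k (\<lambda>y. g y $ l $ j) x
         - partial \<phi> l (\<lambda>y. g y $ j $ k) x)) / 2"

lemma partial_cong:
  fixes \<phi> :: "('m::topological_space, 'n::finite) chart"
  assumes "is_chart \<phi>" "x \<in> chart_dom \<phi>" "\<And>y. y \<in> chart_dom \<phi> \<Longrightarrow> f y = h y"
    and "(f \<circ> chart_inv \<phi>) differentiable (at (chart_map \<phi> x))"
  shows "partial \<phi> i f x = partial \<phi> i h x"
proof -
  have "frechet_derivative (f \<circ> chart_inv \<phi>) (at (chart_map \<phi> x))
      = frechet_derivative (h \<circ> chart_inv \<phi>) (at (chart_map \<phi> x))"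
  proof (rule frechet_derivative_transform_within_open[OF assms(4)])
    show "open (chart_map \<phi> ` chart_dom \<phi>)" using assms(1) by (simp add: is_chart_def)
    show "chart_map \<phi> x \<in> chart_map \<phi> ` chart_dom \<phi>" using assms(2) by simp
    fix z assume "z \<in> chart_map \<phi> ` chart_dom \<phi>"
    then show "(f \<circ> chart_inv \<phi>) z = (h \<circ> chart_inv \<phi>) z"
      using assms(1,3) by (auto simp: is_chart_def homeomorphism_def)
  qed
  then show ?thesis by (simp add: partial_def)
qed

text \<open>
  Levi-Civita property: among all connection coefficients, the Christoffel symbols are the unique
  ones that are torsion-free and parallelize the metric.
\<close>

lemma christoffel_unique:
  fixes \<phi> :: "('m::topological_space, 'n::finite) chart" and g :: "'m \<Rightarrow> real^'n^'n"
  assumes "is_chart \<phi>" "x \<in> chart_dom \<phi>"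
    and sym: "\<And>y. y \<in> chart_dom \<phi> \<Longrightarrow> transpose (g y) = g y"
    and inv: "invertible (g x)"
    and smooth: "\<And>i j. smooth_in_chart \<phi> (\<lambda>y. g y $ i $ j)"
  shows "(\<forall>i j k. \<Gamma> i j k = christoffel \<phi> g i j k x) \<longleftrightarrow>
     (\<forall>i j k. \<Gamma> i j k = \<Gamma> i k j) \<and>
     (\<forall>i j k. partial \<phi> k (\<lambda>y. g y $ i $ j) x
        - (\<Sum>l\<in>UNIV. \<Gamma> l k i * g x $ l $ j) - (\<Sum>l\<in>UNIV. \<Gamma> l k j * g x $ i $ l) = 0)"
proof -
  define D where "D k i j = partial \<phi> k (\<lambda>y. g y $ i $ j) x" for k i j
  define L where "L i j k = (\<Sum>l\<in>UNIV. g x $ i $ l * \<Gamma> l j k)" for i j k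
  have gs: "g y $ i $ j = g y $ j $ i" if "y \<in> chart_dom \<phi>" for y i j
    using arg_cong[OF sym[OF that], of "\<lambda>M. M $ j $ i"] by (simp add: transpose_def)
  have Dsym: "D k i j = D k j i" for k i j
    unfolding D_def
  proof (rule partial_cong[OF assms(1,2)])
    show "((\<lambda>y. g y $ i $ j) \<circ> chart_inv \<phi>) differentiable at (chart_map \<phi> x)"
      using spec[OF smooth[of i j, unfolded smooth_in_chart_def smooth_on_def], of "Suc 0"] assms(2)
      by simp
  qed (rule gs)
  have inverse: "g x ** matrix_inv (g x) = mat 1 \<and> matrix_inv (g x) ** g x = mat 1"
    unfolding matrix_inv_def by (rule someI_ex[OF inv[unfolded invertible_def]])
  have l1: "(\<Sum>j\<in>UNIV. matrix_inv (g x) $ i $ j * g x $ j $ k) = (if i = k then 1 else 0)" for i k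
  proof -
    have "matrix_inv (g x) ** g x = mat 1" using inverse by blast
    then have "(matrix_inv (g x) ** g x) $ i $ k = mat 1 $ i $ k" by simp
    then show ?thesis by (simp add: matrix_matrix_mult_def mat_def)
  qed
  have l2: "(\<Sum>j\<in>UNIV. g x $ i $ j * matrix_inv (g x) $ j $ k) = (if i = k then 1 else 0)" for i k
  proof -
    have "g x ** matrix_inv (g x) = mat 1" using inverse by blast
    then have "(g x ** matrix_inv (g x)) $ i $ k = mat 1 $ i $ k" by simp
    then show ?thesis by (simp add: matrix_matrix_mult_def mat_def)
  qed
  have raise: "(\<Sum>l\<in>UNIV. matrix_inv (g x) $ i $ l * L l j k) = \<Gamma> i j k" for i j k
  proof -
    have "(\<Sum>l\<in>UNIV. matrix_inv (g x) $ i $ l * L l j k)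
        = (\<Sum>m\<in>UNIV. (\<Sum>l\<in>UNIV. matrix_inv (g x) $ i $ l * g x $ l $ m) * \<Gamma> m j k)"
      unfolding L_def sum_distrib_left sum_distrib_right
      by (subst sum.swap) (simp add: mult.assoc)
    also have "\<dots> = \<Gamma> i j k" by (simp add: l1 if_distrib[of "\<lambda>z. z * _"] cong: if_cong)
    finally show ?thesis .
  qed
  have lower: "(\<Sum>l\<in>UNIV. g x $ i $ l * (\<Sum>m\<in>UNIV. matrix_inv (g x) $ l $ m * E m)) = E i" for i E
  proof -
    have "(\<Sum>l\<in>UNIV. g x $ i $ l * (\<Sum>m\<in>UNIV. matrix_inv (g x) $ l $ m * E m))
        = (\<Sum>m\<in>UNIV. (\<Sum>l\<in>UNIV. g x $ i $ l * matrix_inv (g x) $ l $ m) * E m)"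
      unfolding sum_distrib_left sum_distrib_right
      by (subst sum.swap) (simp add: mult.assoc)
    also have "\<dots> = E i" by (simp add: l2 if_distrib[of "\<lambda>z. z * _"] cong: if_cong)
    finally show ?thesis .
  qed
  have chr: "christoffel \<phi> g i j k x
      = (\<Sum>l\<in>UNIV. matrix_inv (g x) $ i $ l * ((D j l k + D k l j - D l j k) / 2))" for i j k
    unfolding christoffel_def D_def ginv_def by (simp add: sum_divide_distrib)
  have "(\<forall>i j k. \<Gamma> i j k = christoffel \<phi> g i j k x) \<longleftrightarrow>
      (\<forall>i j k. L i j k = (D j i k + D k i j - D i j k) / 2)"
  proof
    assume a: "\<forall>i j k. \<Gamma> i j k = christoffel \<phi> g i j k x"
    show "\<forall>i j k. L i j k = (D j i k + D k i j - D i j k) / 2"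
      by (intro allI) (simp only: L_def a[rule_format] chr lower)
  next
    assume a: "\<forall>i j k. L i j k = (D j i k + D k i j - D i j k) / 2"
    show "\<forall>i j k. \<Gamma> i j k = christoffel \<phi> g i j k x"
      by (intro allI) (simp only: raise[symmetric] a[rule_format] chr)
  qed
  also have "\<dots> \<longleftrightarrow> (\<forall>i j k. L i j k = L i k j) \<and> (\<forall>i j k. D k i j = L j k i + L i k j)"
    (is "?l = ?r")
  proof
    assume l: ?l
    show ?r
    proof (intro conjI allI)
      fix i j k
      show "L i j k = L i k j" using l[rule_format, of i j k] l[rule_format, of i k j] Dsym[of i j k] by simp
      show "D k i j = L j k i + L i k j"
        using l[rule_format, of j k i] l[rule_format, of i k j] Dsym[of k i j] Dsym[of i j k] Dsym[of j i k]
        by simp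
    qed
  next
    assume r: ?r
    show ?l
    proof (intro allI)
      fix i j k
      have "D j i k = L k j i + L i j k" "D k i j = L j k i + L i k j" "D i j k = L k i j + L j i k"
        using r by blast+
      moreover have "L k j i = L k i j" "L i j k = L i k j" "L j k i = L j i k" using r by blast+
      ultimately show "L i j k = (D j i k + D k i j - D i j k) / 2" by simp
    qed
  qed
  also have "(\<forall>i j k. L i j k = L i k j) \<longleftrightarrow> (\<forall>i j k. \<Gamma> i j k = \<Gamma> i k j)"
  proof
    assume s: "\<forall>i j k. L i j k = L i k j"
    show "\<forall>i j k. \<Gamma> i j k = \<Gamma> i k j"
    proof (intro allI)
      fix i j k
      have "(\<Sum>l\<in>UNIV. matrix_inv (g x) $ i $ l * L l j k)
          = (\<Sum>l\<in>UNIV. matrix_inv (g x) $ i $ l * L l k j)" using s by (intro sum.cong) auto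
      then show "\<Gamma> i j k = \<Gamma> i k j" by (simp only: raise)
    qed
  next
    assume s: "\<forall>i j k. \<Gamma> i j k = \<Gamma> i k j"
    show "\<forall>i j k. L i j k = L i k j"
      unfolding L_def using s by (intro allI sum.cong) auto
  qed
  also have "(\<forall>i j k. D k i j = L j k i + L i k j) \<longleftrightarrow>
     (\<forall>i j k. partial \<phi> k (\<lambda>y. g y $ i $ j) x
        - (\<Sum>l\<in>UNIV. \<Gamma> l k i * g x $ l $ j) - (\<Sum>l\<in>UNIV. \<Gamma> l k j * g x $ i $ l) = 0)"
  proof -
    have "(\<Sum>l\<in>UNIV. \<Gamma> l k i * g x $ l $ j) = L j k i" for i j k
      unfolding L_def by (intro sum.cong) (auto simp: gs[OF assms(2)])
    moreover have "(\<Sum>l\<in>UNIV. \<Gamma> l k j * g x $ i $ l) = L i k j" for i j k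
      unfolding L_def by (intro sum.cong) auto
    ultimately show ?thesis unfolding D_def by (simp add: algebra_simps)
  qed
  finally show ?thesis .
qed

definition cov_vec ::
    "('m, 'n::finite) chart \<Rightarrow> ('m \<Rightarrow> real^'n^'n) \<Rightarrow> ('m \<Rightarrow> real^'n) \<Rightarrow> ('m \<Rightarrow> real^'n) \<Rightarrow> 'm \<Rightarrow> real^'n"
  where
  "cov_vec \<phi> g X Y x = (\<chi> i. \<Sum>j\<in>UNIV. X x $ j *
     (partial \<phi> j (\<lambda>y. Y y $ i) x + (\<Sum>k\<in>UNIV. christoffel \<phi> g i j k x * Y x $ k)))"

definition lie_bracket ::
    "('m, 'n::finite) chart \<Rightarrow> ('m \<Rightarrow> real^'n) \<Rightarrow> ('m \<Rightarrow> real^'n) \<Rightarrow> 'm \<Rightarrow> real^'n" where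
  "lie_bracket \<phi> X Y x = (\<chi> i. \<Sum>j\<in>UNIV.
     X x $ j * partial \<phi> j (\<lambda>y. Y y $ i) x - Y x $ j * partial \<phi> j (\<lambda>y. X y $ i) x)"

definition curvature ::
    "('m, 'n::finite) chart \<Rightarrow> ('m \<Rightarrow> real^'n^'n) \<Rightarrow> ('m \<Rightarrow> real^'n) \<Rightarrow> ('m \<Rightarrow> real^'n) \<Rightarrow>
     ('m \<Rightarrow> real^'n) \<Rightarrow> ('m \<Rightarrow> real^'n) \<Rightarrow> 'm \<Rightarrow> real" where
  "curvature \<phi> g X Y Z T x =
     (g x *v (cov_vec \<phi> g X (cov_vec \<phi> g Y Z) x - cov_vec \<phi> g Y (cov_vec \<phi> g X Z) x
              - cov_vec \<phi> g (lie_bracket \<phi> X Y) Z x)) \<bullet> T x"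

definition riemann ::
    "('m, 'n::finite) chart \<Rightarrow> ('m \<Rightarrow> real^'n^'n) \<Rightarrow> 'n \<Rightarrow> 'n \<Rightarrow> 'n \<Rightarrow> 'n \<Rightarrow> 'm \<Rightarrow> real" where
  "riemann \<phi> g a b c d =
     curvature \<phi> g (\<lambda>_. axis a 1) (\<lambda>_. axis b 1) (\<lambda>_. axis c 1) (\<lambda>_. axis d 1)"

definition ricci ::
    "('m, 'n::finite) chart \<Rightarrow> ('m \<Rightarrow> real^'n^'n) \<Rightarrow> 'n \<Rightarrow> 'n \<Rightarrow> 'm \<Rightarrow> real" where
  "ricci \<phi> g b c x = (\<Sum>a\<in>UNIV. \<Sum>d\<in>UNIV. ginv g a d x * riemann \<phi> g a b c d x)"

definition scalar_curvature ::
    "('m, 'n::finite) chart \<Rightarrow> ('m \<Rightarrow> real^'n^'n) \<Rightarrow> 'm \<Rightarrow> real" where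
  "scalar_curvature \<phi> g x = (\<Sum>b\<in>UNIV. \<Sum>c\<in>UNIV. ginv g b c x * ricci \<phi> g b c x)"

definition W_low :: "('m, 4) chart \<Rightarrow> ('m \<Rightarrow> real^4^4) \<Rightarrow> 4 \<Rightarrow> 4 \<Rightarrow> 4 \<Rightarrow> 4 \<Rightarrow> 'm \<Rightarrow> real" where
  "W_low \<phi> g a b c d x = riemann \<phi> g a b c d x
     + (1/3) * (g x $ a $ c * ricci \<phi> g b d x - g x $ b $ c * ricci \<phi> g a d x)"

definition W_up :: "('m, 4) chart \<Rightarrow> ('m \<Rightarrow> real^4^4) \<Rightarrow> 4 \<Rightarrow> 4 \<Rightarrow> 4 \<Rightarrow> 4 \<Rightarrow> 'm \<Rightarrow> real" where
  "W_up \<phi> g h b c d x = (\<Sum>a\<in>UNIV. ginv g h a x * W_low \<phi> g a b c d x)"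

text \<open>
  In the covariant derivatives the first index is the direction: \<open>cov_up \<phi> g Y b a\<close> is
  \<open>\<nabla>\<^sub>b Y\<^sup>a\<close>, \<open>cov_low \<phi> g w b a\<close> is \<open>\<nabla>\<^sub>b w\<^sub>a\<close>, and
  \<open>cov13 \<phi> g S e a b c d\<close> is \<open>\<nabla>\<^sub>e S\<^sup>a\<^bsub>bcd\<^esub>\<close>.
\<close>

definition cov_up ::
    "('m, 'n::finite) chart \<Rightarrow> ('m \<Rightarrow> real^'n^'n) \<Rightarrow> ('m \<Rightarrow> real^'n) \<Rightarrow> 'n \<Rightarrow> 'n \<Rightarrow> 'm \<Rightarrow> real" where
  "cov_up \<phi> g Y b a x = cov_vec \<phi> g (\<lambda>_. axis b 1) Y x $ a"

definition cov_low ::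
    "('m, 'n::finite) chart \<Rightarrow> ('m \<Rightarrow> real^'n^'n) \<Rightarrow> ('m \<Rightarrow> real^'n) \<Rightarrow> 'n \<Rightarrow> 'n \<Rightarrow> 'm \<Rightarrow> real" where
  "cov_low \<phi> g w b a x =
     partial \<phi> b (\<lambda>y. w y $ a) x - (\<Sum>f\<in>UNIV. christoffel \<phi> g f b a x * w x $ f)"

definition cov13 ::
    "('m, 'n::finite) chart \<Rightarrow> ('m \<Rightarrow> real^'n^'n) \<Rightarrow> ('n \<Rightarrow> 'n \<Rightarrow> 'n \<Rightarrow> 'n \<Rightarrow> 'm \<Rightarrow> real) \<Rightarrow>
     'n \<Rightarrow> 'n \<Rightarrow> 'n \<Rightarrow> 'n \<Rightarrow> 'n \<Rightarrow> 'm \<Rightarrow> real" where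
  "cov13 \<phi> g S e a b c d x = partial \<phi> e (S a b c d) x
     + (\<Sum>f\<in>UNIV. christoffel \<phi> g a e f x * S f b c d x)
     - (\<Sum>f\<in>UNIV. christoffel \<phi> g f e b x * S a f c d x)
     - (\<Sum>f\<in>UNIV. christoffel \<phi> g f e c x * S a b f d x)
     - (\<Sum>f\<in>UNIV. christoffel \<phi> g f e d x * S a b c f x)"

definition W_conserved ::
    "('m, 4) chart set \<Rightarrow> (('m, 4) chart \<Rightarrow> 'm \<Rightarrow> real^4^4) \<Rightarrow> bool" where
  "W_conserved A g \<longleftrightarrow> (\<forall>\<phi>\<in>A. \<forall>x\<in>chart_dom \<phi>. \<forall>b c d.
     (\<Sum>h\<in>UNIV. cov13 \<phi> (g \<phi>) (W_up \<phi> (g \<phi>)) h h b c d x) = 0)"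

definition einstein_spacetime ::
    "('m, 4) chart set \<Rightarrow> (('m, 4) chart \<Rightarrow> 'm \<Rightarrow> real^4^4) \<Rightarrow> bool" where
  "einstein_spacetime A g \<longleftrightarrow> (\<forall>\<phi>\<in>A. \<forall>x\<in>chart_dom \<phi>. \<forall>a b.
     ricci \<phi> (g \<phi>) a b x = scalar_curvature \<phi> (g \<phi>) x / 4 * g \<phi> x $ a $ b)"

section \<open>Perfect fluids\<close>

definition lower :: "('m \<Rightarrow> real^'n^'n) \<Rightarrow> ('m \<Rightarrow> real^'n) \<Rightarrow> 'm \<Rightarrow> real^'n::finite" where
  "lower g u x = g x *v u x"

definition unit_timelike ::
    "('m, 'n::finite) chart set \<Rightarrow> (('m, 'n) chart \<Rightarrow> 'm \<Rightarrow> real^'n^'n) \<Rightarrow>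
     (('m, 'n) chart \<Rightarrow> 'm \<Rightarrow> real^'n) \<Rightarrow> bool" where
  "unit_timelike A g u \<longleftrightarrow> (\<forall>\<phi>\<in>A. \<forall>x\<in>chart_dom \<phi>.
     (\<Sum>a\<in>UNIV. lower (g \<phi>) (u \<phi>) x $ a * u \<phi> x $ a) = -1)"

definition perfect_fluid_tensor ::
    "('m \<Rightarrow> real^'n^'n::finite) \<Rightarrow> ('m \<Rightarrow> real^'n) \<Rightarrow> ('m \<Rightarrow> real) \<Rightarrow> ('m \<Rightarrow> real) \<Rightarrow>
     'n \<Rightarrow> 'n \<Rightarrow> 'm \<Rightarrow> real" where
  "perfect_fluid_tensor g u \<mu> p a b x =
     (\<mu> x + p x) * lower g u x $ a * lower g u x $ b + p x * g x $ a $ b"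

definition einstein_equations ::
    "('m, 4) chart set \<Rightarrow> (('m, 4) chart \<Rightarrow> 'm \<Rightarrow> real^4^4) \<Rightarrow> real \<Rightarrow>
     (('m, 4) chart \<Rightarrow> 4 \<Rightarrow> 4 \<Rightarrow> 'm \<Rightarrow> real) \<Rightarrow> bool" where
  "einstein_equations A g k T \<longleftrightarrow> (\<forall>\<phi>\<in>A. \<forall>x\<in>chart_dom \<phi>. \<forall>a b.
     ricci \<phi> (g \<phi>) a b x - 1/2 * scalar_curvature \<phi> (g \<phi>) x * g \<phi> x $ a $ b = k * T \<phi> a b x)"

definition proj ::
    "('m \<Rightarrow> real^'n^'n::finite) \<Rightarrow> ('m \<Rightarrow> real^'n) \<Rightarrow> 'n \<Rightarrow> 'n \<Rightarrow> 'm \<Rightarrow> real" where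
  "proj g u a b x = g x $ a $ b + lower g u x $ a * lower g u x $ b"

text \<open>\<open>proj_mixed g u a c\<close> is \<open>h\<^sub>a\<^sup>c\<close>.\<close>

definition proj_mixed ::
    "('m \<Rightarrow> real^'n^'n::finite) \<Rightarrow> ('m \<Rightarrow> real^'n) \<Rightarrow> 'n \<Rightarrow> 'n \<Rightarrow> 'm \<Rightarrow> real" where
  "proj_mixed g u a c x = (\<Sum>e\<in>UNIV. proj g u a e x * ginv g e c x)"

definition expansion ::
    "('m, 'n::finite) chart \<Rightarrow> ('m \<Rightarrow> real^'n^'n) \<Rightarrow> ('m \<Rightarrow> real^'n) \<Rightarrow> 'm \<Rightarrow> real" where
  "expansion \<phi> g u x = (\<Sum>a\<in>UNIV. cov_up \<phi> g u a a x)"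

definition acceleration ::
    "('m, 'n::finite) chart \<Rightarrow> ('m \<Rightarrow> real^'n^'n) \<Rightarrow> ('m \<Rightarrow> real^'n) \<Rightarrow> 'n \<Rightarrow> 'm \<Rightarrow> real" where
  "acceleration \<phi> g u a x = (\<Sum>b\<in>UNIV. u x $ b * cov_low \<phi> g (lower g u) b a x)"

definition shear ::
    "('m, 4) chart \<Rightarrow> ('m \<Rightarrow> real^4^4) \<Rightarrow> ('m \<Rightarrow> real^4) \<Rightarrow> 4 \<Rightarrow> 4 \<Rightarrow> 'm \<Rightarrow> real" where
  "shear \<phi> g u a b x =
     (\<Sum>c\<in>UNIV. \<Sum>d\<in>UNIV. proj_mixed g u a c x * proj_mixed g u b d x *
        ((cov_low \<phi> g (lower g u) d c x + cov_low \<phi> g (lower g u) c d x) / 2))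
     - 1/3 * expansion \<phi> g u x * proj g u a b x"

definition rotation ::
    "('m, 4) chart \<Rightarrow> ('m \<Rightarrow> real^4^4) \<Rightarrow> ('m \<Rightarrow> real^4) \<Rightarrow> 4 \<Rightarrow> 4 \<Rightarrow> 'm \<Rightarrow> real" where
  "rotation \<phi> g u a b x =
     (\<Sum>c\<in>UNIV. \<Sum>d\<in>UNIV. proj_mixed g u a c x * proj_mixed g u b d x *
        ((cov_low \<phi> g (lower g u) d c x - cov_low \<phi> g (lower g u) c d x) / 2))"

definition FRW_model ::
    "('m, 4) chart set \<Rightarrow> (('m, 4) chart \<Rightarrow> 'm \<Rightarrow> real^4^4) \<Rightarrow> (('m, 4) chart \<Rightarrow> 'm \<Rightarrow> real^4) \<Rightarrow>
     ('m \<Rightarrow> real) \<Rightarrow> ('m \<Rightarrow> real) \<Rightarrow> bool" where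
  "FRW_model A g u \<mu> p \<longleftrightarrow>
     (\<forall>x. \<mu> x + p x \<noteq> 0) \<and>
     (\<forall>\<phi>\<in>A. \<forall>x\<in>chart_dom \<phi>.
        (\<forall>a. acceleration \<phi> (g \<phi>) (u \<phi>) a x = 0) \<and>
        (\<forall>a b. shear \<phi> (g \<phi>) (u \<phi>) a b x = 0) \<and>
        (\<forall>a b. rotation \<phi> (g \<phi>) (u \<phi>) a b x = 0) \<and>
        (\<forall>a. (\<Sum>b\<in>UNIV. proj_mixed (g \<phi>) (u \<phi>) a b x * partial \<phi> b \<mu> x) = 0) \<and>
        (\<forall>a. (\<Sum>b\<in>UNIV. proj_mixed (g \<phi>) (u \<phi>) a b x * partial \<phi> b p x) = 0))"

end

theory Submission
  imports Defs
begin

text \<open>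
  Symmetrizing \<open>\<nabla>\<^sub>h W\<^sup>h\<^bsub>bcd\<^esub> = 0\<close> in \<open>c\<close> and \<open>d\<close> removes the Riemann term and leaves
  \<open>\<nabla>\<^sub>c R\<^bsub>bd\<^esub> + \<nabla>\<^sub>d R\<^bsub>bc\<^esub> = g\<^bsub>bc\<^esub> D\<^sub>d + g\<^bsub>bd\<^esub> D\<^sub>c\<close>, where \<open>D\<^sub>d = \<nabla>\<^sub>h R\<^sup>h\<^sub>d\<close>.  As the Ricci tensor is
  symmetric, this can be solved cyclically for \<open>\<nabla>\<^sub>c R\<^bsub>bd\<^esub> = g\<^bsub>bd\<^esub> D\<^sub>c\<close>.  By the field equations
  \<open>R\<^bsub>bd\<^esub> = \<alpha> u\<^sub>b u\<^sub>d + \<beta> g\<^bsub>bd\<^esub>\<close> with \<open>\<alpha> = k(\<mu> + p)\<close> and \<open>\<beta> = k(\<mu> - p)/2\<close>, and contractions with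
  \<open>u\<close> and \<open>g\<close> give \<open>\<nabla>\<alpha> = 0\<close> and \<open>\<alpha> \<nabla>u = 0\<close>.  If the constant \<open>\<alpha>\<close> vanishes, the spacetime is
  Einstein.  Otherwise \<open>u\<close> is parallel, so \<open>R\<^bsub>bd\<^esub> u\<^sup>d = 0\<close> by the Ricci identity; hence
  \<open>\<alpha> = \<beta>\<close>, and both \<open>\<mu>\<close> and \<open>p\<close> are constant.
\<close>

section \<open>Smooth functions\<close>

text \<open>Openness of \<open>S\<close> matters: a derivative at a point depends on the values
  nearby, and the derivative rules below give formulas that hold on \<open>S\<close> only.\<close>

lemma Ck_on_cong:
  assumes "open S" "\<And>x. x \<in> S \<Longrightarrow> f x = h x" "Ck_on m S f"
  shows "Ck_on m S h"
  using assms(2,3)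
proof (induction m arbitrary: f h)
  case 0
  then show ?case using continuous_on_cong[OF refl, of S f h] by simp
next
  case (Suc m)
  have d: "f differentiable (at x)" if "x \<in> S" for x
    using Suc.prems(2) that by simp
  have "h differentiable (at x)" if "x \<in> S" for x
    using d[OF that] Suc.prems(1) assms(1) that
    by (meson differentiable_def has_derivative_transform_within_open)
  moreover have "Ck_on m S (\<lambda>x. frechet_derivative h (at x) (axis i 1))" for i
  proof (rule Suc.IH)
    show "Ck_on m S (\<lambda>x. frechet_derivative f (at x) (axis i 1))" using Suc.prems(2) by simp
  next
    fix x assume "x \<in> S"
    then show "frechet_derivative f (at x) (axis i 1) = frechet_derivative h (at x) (axis i 1)"
      using frechet_derivative_transform_within_open[OF d assms(1) _ Suc.prems(1)] by simp
  qed
  ultimately show ?case by simp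
qed

lemma Ck_on_SucD: "Ck_on (Suc m) S f \<Longrightarrow> Ck_on m S f"
proof (induction m arbitrary: f)
  case 0
  then show ?case
    by (auto intro!: continuous_at_imp_continuous_on differentiable_imp_continuous_within)
next
  case (Suc m)
  then show ?case by (metis Ck_on.simps(2))
qed

lemma smooth_on_cong:
  "open S \<Longrightarrow> (\<And>x. x \<in> S \<Longrightarrow> f x = h x) \<Longrightarrow> smooth_on S f \<Longrightarrow> smooth_on S h"
  unfolding smooth_on_def by (blast intro: Ck_on_cong)

lemma smooth_on_differentiable: "smooth_on S f \<Longrightarrow> x \<in> S \<Longrightarrow> f differentiable (at x)"
  unfolding smooth_on_def by (metis Ck_on.simps(2))

lemma smooth_on_continuous: "smooth_on S f \<Longrightarrow> continuous_on S f"
  unfolding smooth_on_def by (metis Ck_on.simps(1))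

lemma smooth_on_deriv:
  "smooth_on S f \<Longrightarrow> smooth_on S (\<lambda>x. frechet_derivative f (at x) (axis i 1))"
  unfolding smooth_on_def by (metis Ck_on.simps(2))

lemma Ck_on_const: "Ck_on m S (\<lambda>_. c)"
  by (induction m arbitrary: c) auto

lemma Ck_on_add:
  assumes "open S" "Ck_on m S f" "Ck_on m S h"
  shows "Ck_on m S (\<lambda>x. f x + h x)"
  using assms(2,3)
proof (induction m arbitrary: f h)
  case 0
  then show ?case by (simp add: continuous_on_add)
next
  case (Suc m)
  have d: "f differentiable (at x)" "h differentiable (at x)" if "x \<in> S" for x
    using Suc.prems that by simp_all
  have "frechet_derivative (\<lambda>x. f x + h x) (at x) v
      = frechet_derivative f (at x) v + frechet_derivative h (at x) v" if "x \<in> S" for x v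
    using frechet_derivative_at[OF has_derivative_add[OF d(1)[OF that, unfolded frechet_derivative_works]
          d(2)[OF that, unfolded frechet_derivative_works]], symmetric] by (rule fun_cong)
  note eq = this
  have "Ck_on m S (\<lambda>x. frechet_derivative (\<lambda>x. f x + h x) (at x) (axis i 1))" for i
    by (rule Ck_on_cong[OF assms(1) eq[symmetric]], assumption, rule Suc.IH)
      (use Suc.prems in simp_all)
  then show ?case using d by (simp add: differentiable_add)
qed

text \<open>The product rule leads to products in which one factor is replaced by its derivative, so
  the induction on the order runs over arbitrary \<open>f\<close> and \<open>h\<close>.\<close>

lemma Ck_on_mult:
  assumes "open S" "Ck_on m S f" "Ck_on m S h"
  shows "Ck_on m S (\<lambda>x. f x * h x)"
  using assms(2,3)
proof (induction m arbitrary: f h)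
  case 0
  then show ?case by (simp add: continuous_on_mult)
next
  case (Suc m)
  have d: "f differentiable (at x)" "h differentiable (at x)" if "x \<in> S" for x
    using Suc.prems that by simp_all
  have eq: "frechet_derivative (\<lambda>x. f x * h x) (at x) v
      = f x * frechet_derivative h (at x) v + frechet_derivative f (at x) v * h x" if "x \<in> S" for x v
    using frechet_derivative_at[OF has_derivative_mult[OF d(1)[OF that, unfolded frechet_derivative_works]
          d(2)[OF that, unfolded frechet_derivative_works]], symmetric] by (rule fun_cong)
  have "Ck_on m S (\<lambda>x. frechet_derivative (\<lambda>x. f x * h x) (at x) (axis i 1))" for i
    by (rule Ck_on_cong[OF assms(1) eq[symmetric]], assumption, rule Ck_on_add[OF assms(1)];
        rule Suc.IH) (use Suc.prems Ck_on_SucD in simp_all)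
  then show ?case using d by simp
qed

text \<open>The derivative of the reciprocal contains the reciprocal again. The induction
  hypothesis, for the same \<open>f\<close>, supplies it to order \<open>m\<close>, and the
  derivative formula then raises the order by one.\<close>

lemma Ck_on_inverse:
  assumes "open S" "Ck_on m S f" "\<And>x. x \<in> S \<Longrightarrow> f x \<noteq> 0"
  shows "Ck_on m S (\<lambda>x. inverse (f x))"
  using assms(2)
proof (induction m)
  case 0
  then show ?case using assms(3) by (simp add: continuous_on_inverse)
next
  case (Suc m)
  have d: "f differentiable (at x)" if "x \<in> S" for x
    using Suc.prems that by simp_all
  have eq: "frechet_derivative (\<lambda>x. inverse (f x)) (at x) v
      = (-1) * (inverse (f x) * frechet_derivative f (at x) v * inverse (f x))" if "x \<in> S" for x v
    using frechet_derivative_at[OF Deriv.has_derivative_inverse[OF assms(3)[OF that] d[OF that, unfolded frechet_derivative_works]],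
        symmetric] by (simp add: fun_eq_iff)
  have "Ck_on m S (\<lambda>x. inverse (f x))" by (rule Suc.IH[OF Ck_on_SucD[OF Suc.prems]])
  then have "Ck_on m S (\<lambda>x. frechet_derivative (\<lambda>x. inverse (f x)) (at x) (axis i 1))" for i
    by (intro Ck_on_cong[OF assms(1) eq[symmetric]] Ck_on_mult[OF assms(1)] Ck_on_const)
      (use Suc.prems in auto)
  then show ?case using d assms(3) by simp
qed

lemma smooth_on_const: "smooth_on S (\<lambda>_. c)"
  by (simp add: smooth_on_def Ck_on_const)

lemma smooth_on_add:
  "open S \<Longrightarrow> smooth_on S f \<Longrightarrow> smooth_on S h \<Longrightarrow> smooth_on S (\<lambda>x. f x + h x)"
  by (simp add: smooth_on_def Ck_on_add)

lemma smooth_on_mult: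
  "open S \<Longrightarrow> smooth_on S f \<Longrightarrow> smooth_on S h \<Longrightarrow> smooth_on S (\<lambda>x. f x * h x)"
  by (simp add: smooth_on_def Ck_on_mult)

lemma smooth_on_inverse:
  "open S \<Longrightarrow> smooth_on S f \<Longrightarrow> (\<And>x. x \<in> S \<Longrightarrow> f x \<noteq> 0) \<Longrightarrow> smooth_on S (\<lambda>x. inverse (f x))"
  by (simp add: smooth_on_def Ck_on_inverse)

section \<open>Symmetry of mixed second derivatives\<close>

lemma has_real_derivative_along_line:
  fixes f :: "'a::real_normed_vector \<Rightarrow> real"
  assumes "f differentiable (at (w + t *\<^sub>R v))"
  shows "((\<lambda>t. f (w + t *\<^sub>R v)) has_real_derivative frechet_derivative f (at (w + t *\<^sub>R v)) v) (at t)"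
proof -
  have "((\<lambda>t. w + t *\<^sub>R v) has_derivative (\<lambda>h. h *\<^sub>R v)) (at t)"
    by (auto intro!: derivative_eq_intros)
  from has_derivative_compose[OF this assms[unfolded frechet_derivative_works]]
  have "((\<lambda>t. f (w + t *\<^sub>R v)) has_derivative
      (\<lambda>h. frechet_derivative f (at (w + t *\<^sub>R v)) (h *\<^sub>R v))) (at t)" .
  moreover have "frechet_derivative f (at (w + t *\<^sub>R v)) (h *\<^sub>R v)
      = frechet_derivative f (at (w + t *\<^sub>R v)) v * h" for h
    using linear_scale[OF linear_frechet_derivative[OF assms], of h v] by simp
  ultimately show ?thesis by (simp add: has_field_derivative_def)
qed

lemma parallelogram_in_ball:
  fixes z :: "'a::real_normed_vector"
  assumes "0 \<le> t" "t \<le> s" "0 \<le> r" "r \<le> s" "s * (norm v + norm w) < e"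
  shows "z + t *\<^sub>R v + r *\<^sub>R w \<in> ball z e"
proof -
  have "norm (t *\<^sub>R v + r *\<^sub>R w) \<le> t * norm v + r * norm w"
    using norm_triangle_ineq[of "t *\<^sub>R v" "r *\<^sub>R w"] assms by simp
  also have "\<dots> \<le> s * norm v + s * norm w"
    using assms by (intro add_mono mult_right_mono) auto
  also have "\<dots> < e" using assms(5) by (simp add: algebra_simps)
  finally have "norm (z - (z + t *\<^sub>R v + r *\<^sub>R w)) < e"
    by (metis add.assoc add_diff_cancel_left' norm_minus_commute)
  then show ?thesis by (simp add: dist_norm)
qed

text \<open>The mean value theorem is applied twice: in direction \<open>v\<close> to the difference
  of \<open>f\<close> along two opposite sides of the parallelogram, then in direction
  \<open>w\<close> to the resulting difference of derivatives along \<open>v\<close>.\<close>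

lemma second_difference_mvt:
  fixes f :: "'a::real_normed_vector \<Rightarrow> real"
  assumes f: "\<And>x. x \<in> ball z e \<Longrightarrow> f differentiable (at x)"
    and df: "\<And>x. x \<in> ball z e \<Longrightarrow> (\<lambda>y. frechet_derivative f (at y) v) differentiable (at x)"
    and s: "0 < s" "s * (norm v + norm w) < e"
  obtains \<xi> \<eta> where "0 < \<xi>" "\<xi> < s" "0 < \<eta>" "\<eta> < s"
    "f (z + s *\<^sub>R v + s *\<^sub>R w) - f (z + s *\<^sub>R v) - f (z + s *\<^sub>R w) + f z =
     s * s * frechet_derivative (\<lambda>y. frechet_derivative f (at y) v) (at (z + \<xi> *\<^sub>R v + \<eta> *\<^sub>R w)) w"
proof -
  note mem = parallelogram_in_ball[OF _ _ _ _ s(2)]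
  let ?D = "\<lambda>x. frechet_derivative f (at x) v"
  have "((\<lambda>t. f (z + s *\<^sub>R w + t *\<^sub>R v) - f (z + t *\<^sub>R v)) has_real_derivative
      ?D (z + s *\<^sub>R w + t *\<^sub>R v) - ?D (z + t *\<^sub>R v)) (at t)" if "0 \<le> t" "t \<le> s" for t
    using mem[of t s] mem[of t 0] that s(1)
    by (intro DERIV_diff has_real_derivative_along_line f) (auto simp: add_ac)
  from MVT2[OF s(1) this] obtain \<xi> where \<xi>: "0 < \<xi>" "\<xi> < s"
    "(f (z + s *\<^sub>R w + s *\<^sub>R v) - f (z + s *\<^sub>R v)) - (f (z + s *\<^sub>R w) - f z)
      = s * (?D (z + s *\<^sub>R w + \<xi> *\<^sub>R v) - ?D (z + \<xi> *\<^sub>R v))" by auto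
  have "((\<lambda>t. ?D (z + \<xi> *\<^sub>R v + t *\<^sub>R w)) has_real_derivative
      frechet_derivative ?D (at (z + \<xi> *\<^sub>R v + t *\<^sub>R w)) w) (at t)" if "0 \<le> t" "t \<le> s" for t
    using mem[of \<xi> t] that \<xi> by (intro has_real_derivative_along_line df) auto
  from MVT2[OF s(1) this] obtain \<eta> where \<eta>: "0 < \<eta>" "\<eta> < s"
    "?D (z + \<xi> *\<^sub>R v + s *\<^sub>R w) - ?D (z + \<xi> *\<^sub>R v)
      = s * frechet_derivative ?D (at (z + \<xi> *\<^sub>R v + \<eta> *\<^sub>R w)) w" by auto
  show ?thesis
    using that[OF \<xi>(1,2) \<eta>(1,2)] \<xi>(3) \<eta>(3) by (simp add: add_ac)
qed

text \<open>The second difference over a parallelogram is unchanged when \<open>v\<close> and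
  \<open>w\<close> trade places. Hence the two mixed derivatives agree at a pair of points as close
  to \<open>z\<close> as desired, and continuity carries the equality to \<open>z\<close>.\<close>

lemma mixed_second_derivatives_commute:
  fixes f :: "'a::real_normed_vector \<Rightarrow> real"
  defines "D \<equiv> \<lambda>v x. frechet_derivative f (at x) v"
  assumes S: "open S" "z \<in> S"
    and f: "\<And>x. x \<in> S \<Longrightarrow> f differentiable (at x)"
    and Dv: "\<And>x. x \<in> S \<Longrightarrow> D v differentiable (at x)"
    and Dw: "\<And>x. x \<in> S \<Longrightarrow> D w differentiable (at x)"
    and cv: "continuous_on S (\<lambda>x. frechet_derivative (D v) (at x) w)"
    and cw: "continuous_on S (\<lambda>x. frechet_derivative (D w) (at x) v)"
  shows "frechet_derivative (D v) (at z) w = frechet_derivative (D w) (at z) v"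
proof (rule ccontr)
  let ?P = "\<lambda>x. frechet_derivative (D v) (at x) w"
  let ?Q = "\<lambda>x. frechet_derivative (D w) (at x) v"
  assume ne: "?P z \<noteq> ?Q z"
  \<comment> \<open>Half of the gap: a value within this distance of \<open>?P z\<close> cannot
    equal a value within it of \<open>?Q z\<close>.\<close>
  define \<epsilon> where "\<epsilon> = \<bar>?P z - ?Q z\<bar> / 2"
  have \<epsilon>: "\<epsilon> > 0" using ne by (simp add: \<epsilon>_def)
  obtain e0 where e0: "e0 > 0" "ball z e0 \<subseteq> S" using S openE by blast
  obtain d1 where d1: "d1 > 0" "\<And>x. x \<in> S \<Longrightarrow> dist x z < d1 \<Longrightarrow> dist (?P x) (?P z) < \<epsilon>"
    using cv[unfolded continuous_on_iff, rule_format, OF S(2) \<epsilon>] by metis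
  obtain d2 where d2: "d2 > 0" "\<And>x. x \<in> S \<Longrightarrow> dist x z < d2 \<Longrightarrow> dist (?Q x) (?Q z) < \<epsilon>"
    using cw[unfolded continuous_on_iff, rule_format, OF S(2) \<epsilon>] by metis
  define e where "e = min e0 (min d1 d2)"
  have e: "e > 0" "ball z e \<subseteq> S" using e0 d1 d2 by (auto simp: e_def)
  \<comment> \<open>The summand 1 keeps the denominator positive when \<open>v\<close> and
    \<open>w\<close> both vanish; with this \<open>s\<close> the parallelogram with sides
    \<open>s v\<close> and \<open>s w\<close> stays in the ball of radius \<open>e\<close>.\<close>
  define s where "s = e / (2 * (norm v + norm w + 1))"
  have s0: "s > 0" using e by (simp add: s_def add_nonneg_pos)
  have n: "2 * (norm v + norm w + 1) > 0" by (simp add: add_nonneg_pos)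
  have "s * (2 * (norm v + norm w + 1)) = e" using n by (simp add: s_def)
  then have s: "s * (norm v + norm w) < e"
    using s0 e mult_nonneg_nonneg[of s "norm v"] mult_nonneg_nonneg[of s "norm w"]
    by (simp add: algebra_simps)
  have s': "s * (norm w + norm v) < e" using s by (simp add: add.commute)
  have mem: "z + t *\<^sub>R v + r *\<^sub>R w \<in> ball z e" if "0 < t" "t < s" "0 < r" "r < s" for t r
    using parallelogram_in_ball[OF _ _ _ _ s] that by simp
  obtain \<xi> \<eta> where 1: "0 < \<xi>" "\<xi> < s" "0 < \<eta>" "\<eta> < s"
    "f (z + s *\<^sub>R v + s *\<^sub>R w) - f (z + s *\<^sub>R v) - f (z + s *\<^sub>R w) + f z
      = s * s * ?P (z + \<xi> *\<^sub>R v + \<eta> *\<^sub>R w)"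
    using second_difference_mvt[OF _ _ s0 s, of z f] f Dv e(2) unfolding D_def by blast
  obtain \<xi>' \<eta>' where 2: "0 < \<xi>'" "\<xi>' < s" "0 < \<eta>'" "\<eta>' < s"
    "f (z + s *\<^sub>R w + s *\<^sub>R v) - f (z + s *\<^sub>R w) - f (z + s *\<^sub>R v) + f z
      = s * s * ?Q (z + \<xi>' *\<^sub>R w + \<eta>' *\<^sub>R v)"
    using second_difference_mvt[OF _ _ s0 s', of z f] f Dw e(2) unfolding D_def by blast
  \<comment> \<open>Both second differences are built from the same four values of
    \<open>f\<close>.\<close>
  have "s * s * ?P (z + \<xi> *\<^sub>R v + \<eta> *\<^sub>R w) = s * s * ?Q (z + \<xi>' *\<^sub>R w + \<eta>' *\<^sub>R v)"
    using 1(5) 2(5)[unfolded add.assoc[of z] add.commute[of "s *\<^sub>R w"], folded add.assoc]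
    by linarith
  then have "?P (z + \<xi> *\<^sub>R v + \<eta> *\<^sub>R w) = ?Q (z + \<eta>' *\<^sub>R v + \<xi>' *\<^sub>R w)"
    using s0 by (simp add: add.assoc[of z] add.commute[of "\<xi>' *\<^sub>R w"])
  moreover have "dist (?P (z + \<xi> *\<^sub>R v + \<eta> *\<^sub>R w)) (?P z) < \<epsilon>"
    using mem[OF 1(1-4)] e(2) by (intro d1(2)) (auto simp: dist_commute e_def)
  moreover have "dist (?Q (z + \<eta>' *\<^sub>R v + \<xi>' *\<^sub>R w)) (?Q z) < \<epsilon>"
    using mem[OF 2(3,4,1,2)] e(2) by (intro d2(2)) (auto simp: dist_commute e_def)
  ultimately show False unfolding \<epsilon>_def dist_real_def by (smt (verit) field_sum_of_halves)
qed

section \<open>Calculus in a chart\<close>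

lemma smooth_on_sum:
  assumes "open S" "finite I" "\<And>i. i \<in> I \<Longrightarrow> smooth_on S (f i)"
  shows "smooth_on S (\<lambda>x. \<Sum>i\<in>I. f i x)"
  using assms(2,3)
  by (induction I rule: finite_induct) (auto intro: smooth_on_const smooth_on_add[OF assms(1)])

lemma smooth_on_prod:
  assumes "open S" "finite I" "\<And>i. i \<in> I \<Longrightarrow> smooth_on S (f i)"
  shows "smooth_on S (\<lambda>x. \<Prod>i\<in>I. f i x)"
  using assms(2,3)
  by (induction I rule: finite_induct) (auto intro: smooth_on_const smooth_on_mult[OF assms(1)])

locale local_chart =
  fixes \<phi> :: "('m::topological_space, 'n::finite) chart"
  assumes chart: "is_chart \<phi>"
begin

abbreviation "U \<equiv> chart_dom \<phi>"

lemma open_image: "open (chart_map \<phi> ` U)"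
  using chart by (simp add: is_chart_def)

lemma chart_inv_map: "x \<in> U \<Longrightarrow> chart_inv \<phi> (chart_map \<phi> x) = x"
  using chart by (simp add: is_chart_def homeomorphism_def)

lemma smooth_cong:
  assumes "\<And>x. x \<in> U \<Longrightarrow> f x = h x" "smooth_in_chart \<phi> f"
  shows "smooth_in_chart \<phi> h"
  using assms(2) unfolding smooth_in_chart_def
  by (rule smooth_on_cong[OF open_image, rotated]) (auto simp: chart_inv_map assms(1))

lemma smooth_const: "smooth_in_chart \<phi> (\<lambda>_. c)"
  by (simp add: smooth_in_chart_def o_def smooth_on_const)

lemma smooth_add:
  "smooth_in_chart \<phi> f \<Longrightarrow> smooth_in_chart \<phi> h \<Longrightarrow> smooth_in_chart \<phi> (\<lambda>x. f x + h x)"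
  by (simp add: smooth_in_chart_def o_def smooth_on_add open_image)

lemma smooth_mult:
  "smooth_in_chart \<phi> f \<Longrightarrow> smooth_in_chart \<phi> h \<Longrightarrow> smooth_in_chart \<phi> (\<lambda>x. f x * h x)"
  by (simp add: smooth_in_chart_def o_def smooth_on_mult open_image)

lemma smooth_diff:
  assumes "smooth_in_chart \<phi> f" "smooth_in_chart \<phi> h"
  shows "smooth_in_chart \<phi> (\<lambda>x. f x - h x)"
  using smooth_add[OF assms(1) smooth_mult[OF smooth_const[of "-1"] assms(2)]] by simp

lemma smooth_divide_const:
  "smooth_in_chart \<phi> f \<Longrightarrow> smooth_in_chart \<phi> (\<lambda>x. f x / c)"
  using smooth_mult[OF _ smooth_const[of "1 / c"]] by simp

lemma smooth_sum:
  "finite I \<Longrightarrow> (\<And>i. i \<in> I \<Longrightarrow> smooth_in_chart \<phi> (f i)) \<Longrightarrow> smooth_in_chart \<phi> (\<lambda>x. \<Sum>i\<in>I. f i x)"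
  by (simp add: smooth_in_chart_def o_def smooth_on_sum open_image)

lemma smooth_prod:
  "finite I \<Longrightarrow> (\<And>i. i \<in> I \<Longrightarrow> smooth_in_chart \<phi> (f i)) \<Longrightarrow> smooth_in_chart \<phi> (\<lambda>x. \<Prod>i\<in>I. f i x)"
  by (simp add: smooth_in_chart_def o_def smooth_on_prod open_image)

lemma smooth_inverse:
  assumes "smooth_in_chart \<phi> f" "\<And>x. x \<in> U \<Longrightarrow> f x \<noteq> 0"
  shows "smooth_in_chart \<phi> (\<lambda>x. inverse (f x))"
  unfolding smooth_in_chart_def o_def
  by (rule smooth_on_inverse[OF open_image])
    (use assms in \<open>auto simp: smooth_in_chart_def o_def chart_inv_map\<close>)

lemma smooth_partial:
  assumes "smooth_in_chart \<phi> f"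
  shows "smooth_in_chart \<phi> (partial \<phi> i f)"
  unfolding smooth_in_chart_def
  by (rule smooth_on_cong[OF open_image _ smooth_on_deriv[OF assms[unfolded smooth_in_chart_def]]])
    (auto simp: partial_def chart_inv_map)

text \<open>The condition is independent of the point, as in a Kronecker delta.\<close>

lemma smooth_if:
  "(P \<Longrightarrow> smooth_in_chart \<phi> f) \<Longrightarrow> (\<not> P \<Longrightarrow> smooth_in_chart \<phi> h) \<Longrightarrow>
   smooth_in_chart \<phi> (\<lambda>x. if P then f x else h x)"
  by (cases P) simp_all

lemmas smooth_intros =
  smooth_const smooth_add smooth_mult smooth_diff smooth_divide_const smooth_sum smooth_partial smooth_if

lemma smooth_differentiable:
  "smooth_in_chart \<phi> f \<Longrightarrow> x \<in> U \<Longrightarrow> (f \<circ> chart_inv \<phi>) differentiable (at (chart_map \<phi> x))"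
  unfolding smooth_in_chart_def by (rule smooth_on_differentiable) auto

lemma partial_smooth_cong:
  "x \<in> U \<Longrightarrow> smooth_in_chart \<phi> f \<Longrightarrow> (\<And>y. y \<in> U \<Longrightarrow> f y = h y) \<Longrightarrow>
   partial \<phi> i f x = partial \<phi> i h x"
  by (rule partial_cong[OF chart]) (auto intro: smooth_differentiable)

lemma partial_const: "partial \<phi> i (\<lambda>_. c) x = 0"
  by (simp add: partial_def o_def)

lemma partial_add:
  assumes "x \<in> U" "smooth_in_chart \<phi> f" "smooth_in_chart \<phi> h"
  shows "partial \<phi> i (\<lambda>y. f y + h y) x = partial \<phi> i f x + partial \<phi> i h x"
  using frechet_derivative_at[OF has_derivative_add[OF
        smooth_differentiable[OF assms(2,1), unfolded frechet_derivative_works]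
        smooth_differentiable[OF assms(3,1), unfolded frechet_derivative_works]], symmetric]
  by (simp add: partial_def o_def)

lemma partial_mult:
  assumes "x \<in> U" "smooth_in_chart \<phi> f" "smooth_in_chart \<phi> h"
  shows "partial \<phi> i (\<lambda>y. f y * h y) x = partial \<phi> i f x * h x + f x * partial \<phi> i h x"
  using frechet_derivative_at[OF has_derivative_mult[OF
        smooth_differentiable[OF assms(2,1), unfolded frechet_derivative_works]
        smooth_differentiable[OF assms(3,1), unfolded frechet_derivative_works]], symmetric]
  by (simp add: partial_def o_def chart_inv_map assms(1))

lemma partial_cmult:
  assumes "x \<in> U" "smooth_in_chart \<phi> f"
  shows "partial \<phi> i (\<lambda>y. c * f y) x = c * partial \<phi> i f x"
  using partial_mult[OF assms(1) smooth_const assms(2)] by (simp add: partial_const)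

lemma partial_sum:
  assumes "x \<in> U" "finite I" "\<And>j. j \<in> I \<Longrightarrow> smooth_in_chart \<phi> (f j)"
  shows "partial \<phi> i (\<lambda>y. \<Sum>j\<in>I. f j y) x = (\<Sum>j\<in>I. partial \<phi> i (f j) x)"
  using assms(2,3)
  by (induction I rule: finite_induct)
    (simp_all add: partial_const partial_add[OF assms(1)] smooth_sum)

lemma partial_commute:
  assumes "x \<in> U" "smooth_in_chart \<phi> f"
  shows "partial \<phi> i (partial \<phi> j f) x = partial \<phi> j (partial \<phi> i f) x"
proof -
  let ?F = "f \<circ> chart_inv \<phi>" and ?S = "chart_map \<phi> ` U"
  have F: "smooth_on ?S ?F" using assms(2) by (simp add: smooth_in_chart_def)
  let ?D = "\<lambda>i z. frechet_derivative ?F (at z) (axis i 1)"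
  have D: "smooth_on ?S (?D i)" for i by (rule smooth_on_deriv[OF F])
  \<comment> \<open>On the chart image \<open>partial\<close> is the coordinate derivative; as this
    image is open, the identity may be differentiated again.\<close>
  have eq: "partial \<phi> i (partial \<phi> j f) x
      = frechet_derivative (?D j) (at (chart_map \<phi> x)) (axis i 1)" for i j
  proof -
    have "frechet_derivative (?D j) (at (chart_map \<phi> x))
        = frechet_derivative (partial \<phi> j f \<circ> chart_inv \<phi>) (at (chart_map \<phi> x))"
      by (rule frechet_derivative_transform_within_open[OF _ open_image])
        (use assms(1) in \<open>auto intro: smooth_on_differentiable[OF D] simp: partial_def chart_inv_map\<close>)
    then show ?thesis by (simp add: partial_def)
  qed
  have "frechet_derivative (?D j) (at (chart_map \<phi> x)) (axis i 1)
      = frechet_derivative (?D i) (at (chart_map \<phi> x)) (axis j 1)"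
    by (rule mixed_second_derivatives_commute[OF open_image])
      (use assms(1) in \<open>auto intro: smooth_on_differentiable[OF F] smooth_on_differentiable[OF D]
        smooth_on_continuous smooth_on_deriv[OF D]\<close>)
  then show ?thesis by (simp add: eq)
qed

text \<open>The Frechet derivative vanishes on the basis and hence everywhere, so the coordinate
  expression is constant on a ball in the image, which is convex. Continuity of the chart map pulls
  the ball back to an open set.\<close>

lemma partial_zero_imp_locally_constant:
  assumes "x \<in> U" "smooth_in_chart \<phi> f" "\<And>y i. y \<in> U \<Longrightarrow> partial \<phi> i f y = 0"
  shows "\<exists>N. open N \<and> x \<in> N \<and> (\<forall>y\<in>N. f y = f x)"
proof -
  let ?F = "f \<circ> chart_inv \<phi>" and ?S = "chart_map \<phi> ` U"
  have F: "smooth_on ?S ?F" using assms(2) by (simp add: smooth_in_chart_def)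
  obtain e where e: "e > 0" "ball (chart_map \<phi> x) e \<subseteq> ?S"
    using open_image assms(1) by (metis imageI openE)
  have d: "(?F has_derivative (\<lambda>h. 0)) (at z within ball (chart_map \<phi> x) e)"
    if z: "z \<in> ball (chart_map \<phi> x) e" for z
  proof -
    obtain y where y: "y \<in> U" "z = chart_map \<phi> y" using e(2) z by blast
    have diff: "?F differentiable (at z)" using smooth_differentiable[OF assms(2) y(1)] y(2) by simp
    then have lin: "linear (frechet_derivative ?F (at z))" by (rule linear_frechet_derivative)
    have "frechet_derivative ?F (at z) h = 0" for h
    proof (rule linear_eq_0_on_span[OF lin, of Basis])
      fix b :: "real^'n" assume "b \<in> Basis"
      then obtain i where "b = axis i 1" by (auto simp: Basis_vec_def)
      then show "frechet_derivative ?F (at z) b = 0"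
        using assms(3)[OF y(1), of i] y(2) by (simp add: partial_def)
    qed simp
    then have "frechet_derivative ?F (at z) = (\<lambda>h. 0)" by auto
    then show ?thesis
      using diff[unfolded frechet_derivative_works] by (simp add: has_derivative_at_withinI)
  qed
  have const: "?F z = ?F (chart_map \<phi> x)" if "z \<in> ball (chart_map \<phi> x) e" for z
    using has_derivative_zero_unique[OF convex_ball d that, of "chart_map \<phi> x"] e by simp
  define N where "N = U \<inter> chart_map \<phi> -` ball (chart_map \<phi> x) e"
  have "continuous_on U (chart_map \<phi>)" "open U"
    using chart by (auto simp: is_chart_def homeomorphism_def)
  then have "open N" unfolding N_def by (intro continuous_open_preimage) auto
  moreover have "x \<in> N" using assms(1) e by (simp add: N_def)
  moreover have "\<forall>y\<in>N. f y = f x"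
    using const assms(1) by (metis N_def IntE vimageE chart_inv_map comp_apply)
  ultimately show ?thesis by blast
qed

end

section \<open>Curvature in a chart\<close>

lemma (in local_chart) smooth_det:
  assumes "\<And>i j. smooth_in_chart \<phi> (\<lambda>x. M x $ i $ j)"
  shows "smooth_in_chart \<phi> (\<lambda>x. det (M x :: real^'k::finite^'k))"
  unfolding det_def by (intro smooth_sum smooth_mult smooth_const smooth_prod assms) auto

lemma matrix_inv_right_left:
  assumes "invertible A"
  shows "A ** matrix_inv A = mat 1" "matrix_inv A ** A = mat 1"
  using someI_ex[OF assms[unfolded invertible_def]] by (auto simp: matrix_inv_def)

text \<open>Column \<open>j\<close> of the inverse solves a linear system whose right-hand side is
  the \<open>j\<close>-th unit vector. The resulting quotient of determinants makes smoothness of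
  the inverse metric visible.\<close>

lemma matrix_inv_cramer:
  fixes A :: "real^'n^'n"
  assumes "invertible A"
  shows "matrix_inv A $ i $ j = det (\<chi> a b. if b = i then (if a = j then 1 else 0) else A $ a $ b) / det A"
proof -
  have "A *v column j (matrix_inv A) = column j (mat 1)"
    using matrix_inv_right_left(1)[OF assms]
    by (simp add: vec_eq_iff column_def matrix_vector_mult_def matrix_matrix_mult_def)
  then have "column j (matrix_inv A)
      = (\<chi> i. det (\<chi> a b. if b = i then column j (mat 1) $ a else A $ a $ b) / det A)"
    using cramer[of A] assms by (simp add: invertible_det_nz)
  then have "column j (matrix_inv A) $ i
      = det (\<chi> a b. if b = i then column j (mat 1) $ a else A $ a $ b) / det A"
    by (simp only: vec_lambda_beta)
  then show ?thesis by (simp add: column_def mat_def cong: if_cong)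
qed

lemma axis_sum: "(\<Sum>j\<in>UNIV. axis a (1::real) $ j * F j) = F (a::'k::finite)"
  by (simp add: axis_def if_distrib[of "\<lambda>z. z * _"] cong: if_cong)

lemma axis_sum': "(\<Sum>j\<in>UNIV. F j * axis a (1::real) $ j) = F (a::'k::finite)"
  by (simp add: axis_def if_distrib[of "\<lambda>z. _ * z"] cong: if_cong)

text \<open>A pseudo-Riemannian metric in one chart, of any signature and dimension.\<close>

locale chart_metric = local_chart \<phi>
  for \<phi> :: "('m::topological_space, 'n::finite) chart" +
  fixes g :: "'m \<Rightarrow> real^'n^'n"
  assumes metric_sym: "y \<in> U \<Longrightarrow> transpose (g y) = g y"
    and metric_inv: "y \<in> U \<Longrightarrow> invertible (g y)"
    and metric_smooth: "smooth_in_chart \<phi> (\<lambda>y. g y $ i $ j)"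
begin

abbreviation "\<Gamma> \<equiv> christoffel \<phi> g"

lemma g_sym: "x \<in> U \<Longrightarrow> g x $ i $ j = g x $ j $ i"
  using arg_cong[OF metric_sym, of x "\<lambda>M. M $ j $ i"] by (simp add: transpose_def)

lemma ginv_left:
  assumes "x \<in> U"
  shows "(\<Sum>j\<in>UNIV. ginv g i j x * g x $ j $ k) = (if i = k then 1 else 0)"
  using arg_cong[OF matrix_inv_right_left(2)[OF metric_inv[OF assms]], of "\<lambda>M. M $ i $ k"]
  by (simp add: matrix_matrix_mult_def mat_def ginv_def)

lemma ginv_smooth: "smooth_in_chart \<phi> (ginv g i j)"
proof -
  have "smooth_in_chart \<phi> (\<lambda>x. det (\<chi> a b. if b = i then (if a = j then 1 else 0) else g x $ a $ b)
      * inverse (det (g x)))"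
    using metric_inv
    by (intro smooth_mult smooth_inverse smooth_det)
      (auto intro!: smooth_intros metric_smooth simp: invertible_det_nz)
  then show ?thesis
    by (rule smooth_cong[rotated]) (simp add: ginv_def matrix_inv_cramer[OF metric_inv] divide_inverse)
qed

lemma christoffel_smooth: "smooth_in_chart \<phi> (\<Gamma> i j k)"
proof -
  have "\<Gamma> i j k = (\<lambda>x. (\<Sum>l\<in>UNIV. ginv g i l x *
        (partial \<phi> j (\<lambda>y. g y $ l $ k) x + partial \<phi> k (\<lambda>y. g y $ l $ j) x
         - partial \<phi> l (\<lambda>y. g y $ j $ k) x)) / 2)"
    by (simp add: fun_eq_iff christoffel_def)
  then show ?thesis by (auto intro!: smooth_intros ginv_smooth metric_smooth)
qed

text \<open>The metricity half of \<open>christoffel_unique\<close>, solved for the derivative of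
  the metric, so that such derivatives can be traded for connection terms.\<close>

lemma metric_parallel:
  assumes "x \<in> U"
  shows "partial \<phi> k (\<lambda>y. g y $ i $ j) x
     = (\<Sum>l\<in>UNIV. \<Gamma> l k i x * g x $ l $ j) + (\<Sum>l\<in>UNIV. \<Gamma> l k j x * g x $ l $ i)"
proof -
  have "partial \<phi> k (\<lambda>y. g y $ i $ j) x
        - (\<Sum>l\<in>UNIV. \<Gamma> l k i x * g x $ l $ j) - (\<Sum>l\<in>UNIV. \<Gamma> l k j x * g x $ i $ l) = 0"
    using iffD1[OF christoffel_unique[OF chart assms metric_sym metric_inv[OF assms] metric_smooth,
        of "\<lambda>i j k. \<Gamma> i j k x"]] by blast
  then show ?thesis by (simp add: g_sym[OF assms, of i])
qed

text \<open>Index convention: \<open>R(\<partial>\<^sub>a, \<partial>\<^sub>b) \<partial>\<^sub>c = \<Sum>i. riemann_mixed i a b c \<partial>\<^sub>i\<close>.\<close>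

definition riemann_mixed :: "'n \<Rightarrow> 'n \<Rightarrow> 'n \<Rightarrow> 'n \<Rightarrow> 'm \<Rightarrow> real" where
  "riemann_mixed i a b c x = partial \<phi> a (\<Gamma> i b c) x - partial \<phi> b (\<Gamma> i a c) x
     + (\<Sum>k\<in>UNIV. \<Gamma> i a k x * \<Gamma> k b c x) - (\<Sum>k\<in>UNIV. \<Gamma> i b k x * \<Gamma> k a c x)"

lemma riemann_mixed_smooth: "smooth_in_chart \<phi> (riemann_mixed i a b c)"
  unfolding riemann_mixed_def[abs_def] by (auto intro!: smooth_intros christoffel_smooth)

lemma cov_vec_axis:
  "cov_vec \<phi> g (\<lambda>_. axis a 1) Y x $ i
   = partial \<phi> a (\<lambda>y. Y y $ i) x + (\<Sum>k\<in>UNIV. \<Gamma> i a k x * Y x $ k)"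
  by (simp add: cov_vec_def axis_sum)

lemma cov_vec_axis_axis: "cov_vec \<phi> g (\<lambda>_. axis a 1) (\<lambda>_. axis c 1) x $ i = \<Gamma> i a c x"
  by (simp add: cov_vec_axis axis_sum' partial_const)

text \<open>Coordinate fields commute and have constant components, so the bracket term vanishes and
  the commutator of covariant derivatives reduces to the classical expression in Christoffel
  symbols.\<close>

lemma riemann_eq:
  "riemann \<phi> g a b c d x = (\<Sum>i\<in>UNIV. g x $ d $ i * riemann_mixed i a b c x)"
proof -
  have "lie_bracket \<phi> (\<lambda>_. axis a 1) (\<lambda>_. axis b 1) = (\<lambda>_. 0)"
    by (simp add: fun_eq_iff lie_bracket_def partial_const vec_eq_iff)
  moreover have "cov_vec \<phi> g (\<lambda>_. 0) Z x = 0" for Z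
    by (simp add: cov_vec_def vec_eq_iff)
  moreover have "(cov_vec \<phi> g (\<lambda>_. axis a 1) (cov_vec \<phi> g (\<lambda>_. axis b 1) (\<lambda>_. axis c 1)) x
      - cov_vec \<phi> g (\<lambda>_. axis b 1) (cov_vec \<phi> g (\<lambda>_. axis a 1) (\<lambda>_. axis c 1)) x) $ i
      = riemann_mixed i a b c x" for i
    by (simp add: cov_vec_axis cov_vec_axis_axis riemann_mixed_def)
      (simp add: cov_vec_axis axis_sum' partial_const cov_vec_def[of _ _ _ "\<lambda>_. axis _ 1"])
  ultimately show ?thesis
    by (simp add: riemann_def curvature_def inner_axis matrix_vector_mult_def)
qed

lemma riemann_smooth: "smooth_in_chart \<phi> (riemann \<phi> g a b c d)"
  unfolding riemann_eq[abs_def] by (auto intro!: smooth_intros riemann_mixed_smooth metric_smooth)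

text \<open>
  Metricity, differentiated once more; the last sum is symmetric in \<open>a\<close> and \<open>b\<close> and
  therefore disappears from the commutator of the two derivatives.
\<close>

lemma second_partial_metric:
  assumes "x \<in> U"
  shows "partial \<phi> a (partial \<phi> b (\<lambda>y. g y $ c $ d)) x =
     (\<Sum>l\<in>UNIV. g x $ d $ l * (partial \<phi> a (\<Gamma> l b c) x + (\<Sum>k\<in>UNIV. \<Gamma> l a k x * \<Gamma> k b c x)))
   + (\<Sum>l\<in>UNIV. g x $ c $ l * (partial \<phi> a (\<Gamma> l b d) x + (\<Sum>k\<in>UNIV. \<Gamma> l a k x * \<Gamma> k b d x)))
   + (\<Sum>l\<in>UNIV. \<Sum>k\<in>UNIV. g x $ k $ l * (\<Gamma> l b c x * \<Gamma> k a d x + \<Gamma> l b d x * \<Gamma> k a c x))"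
proof -
  have half: "(\<Sum>l\<in>UNIV. partial \<phi> a (\<lambda>y. \<Gamma> l b c y * g y $ l $ d) x)
      = (\<Sum>l\<in>UNIV. g x $ d $ l * (partial \<phi> a (\<Gamma> l b c) x + (\<Sum>k\<in>UNIV. \<Gamma> l a k x * \<Gamma> k b c x)))
      + (\<Sum>l\<in>UNIV. \<Sum>k\<in>UNIV. g x $ k $ l * (\<Gamma> l b c x * \<Gamma> k a d x))" for c d
  proof -
    have "(\<Sum>l\<in>UNIV. partial \<phi> a (\<lambda>y. \<Gamma> l b c y * g y $ l $ d) x)
      = (\<Sum>l\<in>UNIV. partial \<phi> a (\<Gamma> l b c) x * g x $ l $ d)
      + (\<Sum>l\<in>UNIV. \<Sum>k\<in>UNIV. \<Gamma> l b c x * (\<Gamma> k a l x * g x $ k $ d))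
      + (\<Sum>l\<in>UNIV. \<Sum>k\<in>UNIV. \<Gamma> l b c x * (\<Gamma> k a d x * g x $ k $ l))"
      by (simp add: partial_mult[OF assms christoffel_smooth metric_smooth] metric_parallel[OF assms]
          sum.distrib distrib_left sum_distrib_left)
    also have "(\<Sum>l\<in>UNIV. \<Sum>k\<in>UNIV. \<Gamma> l b c x * (\<Gamma> k a l x * g x $ k $ d))
      = (\<Sum>l\<in>UNIV. \<Sum>k\<in>UNIV. g x $ d $ l * (\<Gamma> l a k x * \<Gamma> k b c x))"
      by (subst sum.swap) (simp add: g_sym[OF assms, of _ d] mult_ac)
    finally show ?thesis
      by (simp add: sum.distrib distrib_left sum_distrib_left g_sym[OF assms, of _ d] mult_ac)
  qed
  have "partial \<phi> a (partial \<phi> b (\<lambda>y. g y $ c $ d)) x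
      = partial \<phi> a (\<lambda>x. (\<Sum>l\<in>UNIV. \<Gamma> l b c x * g x $ l $ d) + (\<Sum>l\<in>UNIV. \<Gamma> l b d x * g x $ l $ c)) x"
    by (rule partial_smooth_cong[OF assms smooth_partial[OF metric_smooth] metric_parallel])
  also have "\<dots> = (\<Sum>l\<in>UNIV. partial \<phi> a (\<lambda>y. \<Gamma> l b c y * g y $ l $ d) x)
      + (\<Sum>l\<in>UNIV. partial \<phi> a (\<lambda>y. \<Gamma> l b d y * g y $ l $ c) x)"
    by (simp add: partial_add[OF assms] partial_sum[OF assms] smooth_sum smooth_mult
        christoffel_smooth metric_smooth)
  finally show ?thesis
    by (simp add: half sum.distrib distrib_left)
qed

text \<open>The partial derivatives of g_cd along \<open>a\<close> and \<open>b\<close> commute. In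
  the expansion by \<open>second_partial_metric\<close> the part \<open>Q\<close> is symmetric in
  \<open>a\<close> and \<open>b\<close>, and antisymmetrizing \<open>P\<close> in them gives the
  curvature.\<close>

lemma riemann_antisym_last:
  assumes "x \<in> U"
  shows "riemann \<phi> g a b c d x = - riemann \<phi> g a b d c x"
proof -
  define P where "P a b c d =
    (\<Sum>l\<in>UNIV. g x $ d $ l * (partial \<phi> a (\<Gamma> l b c) x + (\<Sum>k\<in>UNIV. \<Gamma> l a k x * \<Gamma> k b c x)))" for a b c d
  define Q where "Q a b c d =
    (\<Sum>l\<in>UNIV. \<Sum>k\<in>UNIV. g x $ k $ l * (\<Gamma> l b c x * \<Gamma> k a d x + \<Gamma> l b d x * \<Gamma> k a c x))" for a b c d
  have R: "riemann \<phi> g a b c d x = P a b c d - P b a c d" for a b c d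
    by (simp add: riemann_eq riemann_mixed_def P_def sum_subtractf[symmetric] algebra_simps)
  have "Q a b c d = Q b a c d"
    unfolding Q_def by (subst sum.swap) (simp add: g_sym[OF assms, of _ _] algebra_simps)
  moreover have "P a b c d + P a b d c + Q a b c d = P b a c d + P b a d c + Q b a c d"
    using partial_commute[OF assms metric_smooth, of a b c d]
    by (simp add: second_partial_metric[OF assms] P_def Q_def)
  ultimately show ?thesis by (simp add: R)
qed

section \<open>The Ricci tensor and divergences of tensor fields\<close>

lemma ricci_smooth: "smooth_in_chart \<phi> (ricci \<phi> g b c)"
  unfolding ricci_def[abs_def] by (auto intro!: smooth_intros riemann_smooth ginv_smooth)

text \<open>The tensor R^h_d; \<open>div11 ricci_mixed\<close> is the covector D of the
  outline.\<close>

definition ricci_mixed :: "'n \<Rightarrow> 'n \<Rightarrow> 'm \<Rightarrow> real" where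
  "ricci_mixed h d x = (\<Sum>a\<in>UNIV. ginv g h a x * ricci \<phi> g a d x)"

lemma ricci_mixed_smooth: "smooth_in_chart \<phi> (ricci_mixed h d)"
  unfolding ricci_mixed_def[abs_def] by (auto intro!: smooth_intros ricci_smooth ginv_smooth)

text \<open>
  \<open>cov2 S e a b\<close> is \<open>\<nabla>\<^sub>e S\<^bsub>ab\<^esub>\<close>, \<open>div11 Q d\<close> is \<open>\<nabla>\<^sub>h Q\<^sup>h\<^sub>d\<close>, and
  \<open>div13 S b c d\<close> is \<open>\<nabla>\<^sub>h S\<^sup>h\<^bsub>bcd\<^esub>\<close>.
\<close>

definition cov2 :: "('n \<Rightarrow> 'n \<Rightarrow> 'm \<Rightarrow> real) \<Rightarrow> 'n \<Rightarrow> 'n \<Rightarrow> 'n \<Rightarrow> 'm \<Rightarrow> real" where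
  "cov2 S e a b x = partial \<phi> e (S a b) x
     - (\<Sum>f\<in>UNIV. \<Gamma> f e a x * S f b x) - (\<Sum>f\<in>UNIV. \<Gamma> f e b x * S a f x)"

definition div11 :: "('n \<Rightarrow> 'n \<Rightarrow> 'm \<Rightarrow> real) \<Rightarrow> 'n \<Rightarrow> 'm \<Rightarrow> real" where
  "div11 Q d x = (\<Sum>h\<in>UNIV. partial \<phi> h (Q h d) x + (\<Sum>f\<in>UNIV. \<Gamma> h h f x * Q f d x)
     - (\<Sum>f\<in>UNIV. \<Gamma> f h d x * Q h f x))"

definition div13 :: "('n \<Rightarrow> 'n \<Rightarrow> 'n \<Rightarrow> 'n \<Rightarrow> 'm \<Rightarrow> real) \<Rightarrow> 'n \<Rightarrow> 'n \<Rightarrow> 'n \<Rightarrow> 'm \<Rightarrow> real" where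
  "div13 S b c d x = (\<Sum>h\<in>UNIV. cov13 \<phi> g S h h b c d x)"

lemma div13_add:
  assumes "x \<in> U" "\<And>a b c d. smooth_in_chart \<phi> (S a b c d)" "\<And>a b c d. smooth_in_chart \<phi> (T a b c d)"
  shows "div13 (\<lambda>a b c d y. S a b c d y + T a b c d y) b c d x = div13 S b c d x + div13 T b c d x"
  unfolding div13_def cov13_def
  by (simp add: partial_add[OF assms] distrib_left sum.distrib sum_subtractf)

lemma div13_cmult:
  assumes "x \<in> U" "\<And>a b c d. smooth_in_chart \<phi> (S a b c d)"
  shows "div13 (\<lambda>a b c d y. r * S a b c d y) b c d x = r * div13 S b c d x"
  unfolding div13_def cov13_def
  by (simp add: partial_cmult[OF assms] right_diff_distrib distrib_left sum_distrib_left mult.left_commute)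

lemma div13_cong:
  assumes "x \<in> U" "\<And>a b c d. smooth_in_chart \<phi> (S a b c d)"
    and "\<And>a b c d y. y \<in> U \<Longrightarrow> S a b c d y = T a b c d y"
  shows "div13 S b c d x = div13 T b c d x"
  unfolding div13_def cov13_def
  by (simp add: partial_smooth_cong[OF assms(1,2) assms(3)] assms(3)[OF assms(1)])

lemma div13_swap: "div13 (\<lambda>a b c d. S a b d c) b c d x = div13 S b d c x"
  unfolding div13_def cov13_def by (simp add: algebra_simps)

text \<open>The Kronecker delta is parallel: the connection terms of \<open>h\<close> and of
  \<open>c\<close> both reduce to the trace of \<open>\<Gamma>\<close> times S_bd and cancel, which
  leaves the derivative in direction \<open>c\<close>.\<close>

lemma div13_delta_left:
  "div13 (\<lambda>h b c d y. if h = c then S b d y else 0) b c d x = cov2 S c b d x"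
proof -
  have p: "partial \<phi> e (\<lambda>y. if h = c then S b d y else 0) x
      = (if h = c then partial \<phi> e (S b d) x else 0)" for e h
    by (simp add: partial_const)
  have q: "(\<Sum>h\<in>UNIV. \<Sum>f\<in>UNIV. if h = c then F f else 0) = (\<Sum>f\<in>UNIV. F f)" for F :: "'n \<Rightarrow> real"
    by (subst sum.swap) simp
  show ?thesis
    unfolding div13_def cov13_def cov2_def p
    by (simp add: sum.distrib sum_subtractf if_distrib[of "\<lambda>z. _ * z"] q cong: if_cong)
qed

text \<open>The metric is parallel and can be pulled out: \<open>metric_parallel\<close> turns its
  derivative into the very connection terms that the lower indices \<open>b\<close> and
  \<open>c\<close> subtract.\<close>

lemma div13_metric_left:
  assumes "x \<in> U" "\<And>h d. smooth_in_chart \<phi> (Q h d)"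
  shows "div13 (\<lambda>h b c d y. g y $ b $ c * Q h d y) b c d x = g x $ b $ c * div11 Q d x"
  unfolding div13_def cov13_def div11_def sum_distrib_left
proof (rule sum.cong[OF refl])
  fix h
  have 1: "(\<Sum>f\<in>UNIV. \<Gamma> f h b x * (g x $ f $ c * Q h d x)) = (\<Sum>f\<in>UNIV. \<Gamma> f h b x * g x $ f $ c) * Q h d x"
    by (simp add: sum_distrib_right mult.assoc)
  have 2: "(\<Sum>f\<in>UNIV. \<Gamma> f h c x * (g x $ b $ f * Q h d x)) = (\<Sum>f\<in>UNIV. \<Gamma> f h c x * g x $ f $ b) * Q h d x"
    by (simp add: sum_distrib_right mult.assoc g_sym[OF assms(1), of b])
  have 3: "(\<Sum>f\<in>UNIV. \<Gamma> h h f x * (g x $ b $ c * Q f d x)) = g x $ b $ c * (\<Sum>f\<in>UNIV. \<Gamma> h h f x * Q f d x)"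
    by (simp add: sum_distrib_left mult.left_commute)
  have 4: "(\<Sum>f\<in>UNIV. \<Gamma> f h d x * (g x $ b $ c * Q h f x)) = g x $ b $ c * (\<Sum>f\<in>UNIV. \<Gamma> f h d x * Q h f x)"
    by (simp add: sum_distrib_left mult.left_commute)
  show "partial \<phi> h (\<lambda>y. g y $ b $ c * Q h d y) x
      + (\<Sum>f\<in>UNIV. \<Gamma> h h f x * (g x $ b $ c * Q f d x))
      - (\<Sum>f\<in>UNIV. \<Gamma> f h b x * (g x $ f $ c * Q h d x))
      - (\<Sum>f\<in>UNIV. \<Gamma> f h c x * (g x $ b $ f * Q h d x))
      - (\<Sum>f\<in>UNIV. \<Gamma> f h d x * (g x $ b $ c * Q h f x))
      = g x $ b $ c * (partial \<phi> h (Q h d) x + (\<Sum>f\<in>UNIV. \<Gamma> h h f x * Q f d x)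
          - (\<Sum>f\<in>UNIV. \<Gamma> f h d x * Q h f x))"
    unfolding 1 2 3 4 partial_mult[OF assms(1) metric_smooth assms(2)] metric_parallel[OF assms(1)]
    by (simp add: algebra_simps)
qed

end

section \<open>Perfect fluids with conserved W-curvature\<close>

context chart_metric
begin

section \<open>Raising and lowering indices; parallel vector fields\<close>

lemma sum_ginv_g:
  assumes "x \<in> U"
  shows "(\<Sum>b\<in>UNIV. \<Sum>c\<in>UNIV. ginv g b c x * g x $ b $ c) = CARD('n)"
proof -
  have "(\<Sum>c\<in>UNIV. ginv g b c x * g x $ b $ c) = 1" for b
    using ginv_left[OF assms, of b b] by (simp add: g_sym[OF assms, of b])
  then show ?thesis by simp
qed

lemma ginv_lower:
  assumes "x \<in> U"
  shows "(\<Sum>d\<in>UNIV. ginv g b d x * lower g u x $ d) = u x $ b"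
proof -
  have "(\<Sum>d\<in>UNIV. ginv g b d x * lower g u x $ d)
      = (\<Sum>e\<in>UNIV. (\<Sum>d\<in>UNIV. ginv g b d x * g x $ d $ e) * u x $ e)"
    unfolding lower_def matrix_vector_mult_def vec_lambda_beta sum_distrib_left sum_distrib_right
    by (subst sum.swap) (simp add: mult.assoc)
  then show ?thesis
    by (simp add: ginv_left[OF assms] if_distrib[of "\<lambda>z. z * _"] cong: if_cong)
qed

lemma lower_smooth: "(\<And>a. smooth_in_chart \<phi> (\<lambda>x. u x $ a)) \<Longrightarrow> smooth_in_chart \<phi> (\<lambda>x. lower g u x $ a)"
  by (auto simp: lower_def matrix_vector_mult_def intro!: smooth_intros metric_smooth)

lemma cov_up_eq: "cov_up \<phi> g u b a x = partial \<phi> b (\<lambda>y. u y $ a) x + (\<Sum>k\<in>UNIV. \<Gamma> a b k x * u x $ k)"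
  by (simp add: cov_up_def cov_vec_axis)

text \<open>Lowering an index commutes with covariant differentiation. Of the two sums in
  \<open>metric_parallel\<close>, one cancels the connection term of the covector and the other
  completes the derivative of \<open>u\<close>.\<close>

lemma cov_low_eq:
  assumes "x \<in> U" "\<And>a. smooth_in_chart \<phi> (\<lambda>x. u x $ a)"
  shows "cov_low \<phi> g (lower g u) b a x = (\<Sum>j\<in>UNIV. g x $ a $ j * cov_up \<phi> g u b j x)"
proof -
  have "partial \<phi> b (\<lambda>y. lower g u y $ a) x
      = (\<Sum>c\<in>UNIV. partial \<phi> b (\<lambda>y. g y $ a $ c) x * u x $ c + g x $ a $ c * partial \<phi> b (\<lambda>y. u y $ c) x)"
    by (simp add: lower_def matrix_vector_mult_def partial_sum[OF assms(1)] smooth_mult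
        metric_smooth assms(2) partial_mult[OF assms(1)])
  also have "\<dots> = (\<Sum>c\<in>UNIV. \<Sum>l\<in>UNIV. \<Gamma> l b a x * g x $ l $ c * u x $ c)
      + (\<Sum>c\<in>UNIV. \<Sum>l\<in>UNIV. \<Gamma> l b c x * g x $ l $ a * u x $ c)
      + (\<Sum>c\<in>UNIV. g x $ a $ c * partial \<phi> b (\<lambda>y. u y $ c) x)"
    by (simp add: metric_parallel[OF assms(1)] sum.distrib distrib_right sum_distrib_right)
  also have "(\<Sum>c\<in>UNIV. \<Sum>l\<in>UNIV. \<Gamma> l b a x * g x $ l $ c * u x $ c)
      = (\<Sum>l\<in>UNIV. \<Gamma> l b a x * lower g u x $ l)"
    unfolding lower_def matrix_vector_mult_def vec_lambda_beta sum_distrib_left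
    by (subst sum.swap) (simp add: mult.assoc)
  also have "(\<Sum>c\<in>UNIV. \<Sum>l\<in>UNIV. \<Gamma> l b c x * g x $ l $ a * u x $ c)
      = (\<Sum>l\<in>UNIV. g x $ a $ l * (\<Sum>c\<in>UNIV. \<Gamma> l b c x * u x $ c))"
    unfolding sum_distrib_left
    by (subst sum.swap) (simp add: g_sym[OF assms(1), of _ a] mult_ac)
  finally show ?thesis
    by (simp add: cov_low_def cov_up_eq distrib_left sum.distrib)
qed

lemma cov_up_eq_cov_low:
  assumes "x \<in> U" "\<And>a. smooth_in_chart \<phi> (\<lambda>x. u x $ a)"
  shows "cov_up \<phi> g u b a x = (\<Sum>i\<in>UNIV. ginv g a i x * cov_low \<phi> g (lower g u) b i x)"
proof -
  have "(\<Sum>i\<in>UNIV. ginv g a i x * cov_low \<phi> g (lower g u) b i x)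
      = (\<Sum>j\<in>UNIV. (\<Sum>i\<in>UNIV. ginv g a i x * g x $ i $ j) * cov_up \<phi> g u b j x)"
    unfolding cov_low_eq[OF assms] sum_distrib_left sum_distrib_right
    by (subst sum.swap) (simp add: mult.assoc)
  then show ?thesis
    by (simp add: ginv_left[OF assms(1)] if_distrib[of "\<lambda>z. z * _"] cong: if_cong)
qed

text \<open>Differentiating the constant norm makes the two contractions with partial derivatives
  opposite. The desired sum is the first contraction minus a connection sum and, by lowering, also
  the second plus the same sum; so it equals its own negative.\<close>

lemma unit_cov_low:
  assumes "x \<in> U" "\<And>a. smooth_in_chart \<phi> (\<lambda>x. u x $ a)"
    and unit: "\<And>y. y \<in> U \<Longrightarrow> (\<Sum>a\<in>UNIV. lower g u y $ a * u y $ a) = C"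
  shows "(\<Sum>a\<in>UNIV. u x $ a * cov_low \<phi> g (lower g u) c a x) = 0"
proof -
  let ?w = "\<lambda>a y. lower g u y $ a"
  have "0 = partial \<phi> c (\<lambda>_. C) x" by (simp add: partial_const)
  also have "\<dots> = partial \<phi> c (\<lambda>y. \<Sum>a\<in>UNIV. ?w a y * u y $ a) x"
    by (rule partial_smooth_cong[OF assms(1) smooth_const]) (simp add: unit)
  also have "\<dots> = (\<Sum>a\<in>UNIV. u x $ a * partial \<phi> c (?w a) x) + (\<Sum>a\<in>UNIV. ?w a x * partial \<phi> c (\<lambda>y. u y $ a) x)"
    by (simp add: partial_sum[OF assms(1)] partial_mult[OF assms(1)] smooth_mult lower_smooth assms(2)
        sum.distrib mult.commute)
  finally have 1: "(\<Sum>a\<in>UNIV. u x $ a * partial \<phi> c (?w a) x)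
      = - (\<Sum>a\<in>UNIV. ?w a x * partial \<phi> c (\<lambda>y. u y $ a) x)" by simp
  have "(\<Sum>a\<in>UNIV. u x $ a * cov_low \<phi> g (lower g u) c a x)
      = (\<Sum>j\<in>UNIV. ?w j x * cov_up \<phi> g u c j x)"
    unfolding cov_low_eq[OF assms(1,2)] lower_def matrix_vector_mult_def vec_lambda_beta
      sum_distrib_left sum_distrib_right
    by (subst sum.swap) (simp add: g_sym[OF assms(1)] mult_ac)
  also have "\<dots> = (\<Sum>j\<in>UNIV. ?w j x * partial \<phi> c (\<lambda>y. u y $ j) x)
      + (\<Sum>j\<in>UNIV. \<Sum>k\<in>UNIV. ?w j x * (\<Gamma> j c k x * u x $ k))"
    by (simp add: cov_up_eq distrib_left sum.distrib sum_distrib_left)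
  finally have 2: "(\<Sum>a\<in>UNIV. u x $ a * cov_low \<phi> g (lower g u) c a x) = \<dots>" .
  have "(\<Sum>a\<in>UNIV. u x $ a * cov_low \<phi> g (lower g u) c a x)
      = (\<Sum>a\<in>UNIV. u x $ a * partial \<phi> c (?w a) x)
      - (\<Sum>a\<in>UNIV. \<Sum>f\<in>UNIV. u x $ a * (\<Gamma> f c a x * ?w f x))"
    by (simp add: cov_low_def right_diff_distrib sum_subtractf sum_distrib_left)
  also have "(\<Sum>a\<in>UNIV. \<Sum>f\<in>UNIV. u x $ a * (\<Gamma> f c a x * ?w f x))
      = (\<Sum>j\<in>UNIV. \<Sum>k\<in>UNIV. ?w j x * (\<Gamma> j c k x * u x $ k))"
    by (subst sum.swap) (simp add: mult_ac)
  finally show ?thesis using 1 2 by linarith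
qed

text \<open>This is the Ricci identity for a parallel field: first derivatives of \<open>u\<close>
  are expressed by \<open>\<Gamma>\<close> and \<open>u\<close>, and the integrability condition
  says that the curvature annihilates \<open>u\<close>. Contraction gives the claim.\<close>

lemma ricci_parallel_vector:
  assumes "x \<in> U" and u: "\<And>a. smooth_in_chart \<phi> (\<lambda>x. u x $ a)"
    and par: "\<And>y b a. y \<in> U \<Longrightarrow> cov_up \<phi> g u b a y = 0"
  shows "(\<Sum>c\<in>UNIV. ricci \<phi> g b c x * u x $ c) = 0"
proof -
  have d: "partial \<phi> b (\<lambda>y. u y $ i) y = (-1) * (\<Sum>k\<in>UNIV. \<Gamma> i b k y * u y $ k)" if "y \<in> U" for y b i
    using par[OF that, of b i] by (simp add: cov_up_eq)
  have dd: "partial \<phi> a (partial \<phi> b (\<lambda>y. u y $ i)) x =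
      - (\<Sum>k\<in>UNIV. partial \<phi> a (\<Gamma> i b k) x * u x $ k)
      + (\<Sum>k\<in>UNIV. (\<Sum>l\<in>UNIV. \<Gamma> i b l x * \<Gamma> l a k x) * u x $ k)" for a b i
  proof -
    have "partial \<phi> a (partial \<phi> b (\<lambda>y. u y $ i)) x
        = partial \<phi> a (\<lambda>y. (-1) * (\<Sum>k\<in>UNIV. \<Gamma> i b k y * u y $ k)) x"
      by (rule partial_smooth_cong[OF assms(1) smooth_partial[OF u] d])
    also have "\<dots> = - (\<Sum>k\<in>UNIV. partial \<phi> a (\<Gamma> i b k) x * u x $ k + \<Gamma> i b k x * partial \<phi> a (\<lambda>y. u y $ k) x)"
      by (subst partial_cmult[OF assms(1)])
        (auto intro!: smooth_intros christoffel_smooth u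
          simp: partial_sum[OF assms(1)] partial_mult[OF assms(1)] smooth_mult christoffel_smooth u)
    also have "\<dots> = - (\<Sum>k\<in>UNIV. partial \<phi> a (\<Gamma> i b k) x * u x $ k)
        + (\<Sum>k\<in>UNIV. \<Sum>l\<in>UNIV. \<Gamma> i b k x * (\<Gamma> k a l x * u x $ l))"
      by (simp add: d[OF assms(1)] sum.distrib sum_subtractf sum_negf sum_distrib_left)
    also have "(\<Sum>k\<in>UNIV. \<Sum>l\<in>UNIV. \<Gamma> i b k x * (\<Gamma> k a l x * u x $ l))
        = (\<Sum>k\<in>UNIV. (\<Sum>l\<in>UNIV. \<Gamma> i b l x * \<Gamma> l a k x) * u x $ k)"
      by (subst sum.swap) (simp add: sum_distrib_right mult.assoc)
    finally show ?thesis .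
  qed
  \<comment> \<open>Equality of the mixed second derivatives of \<open>u\<close>, both expanded by
    \<open>dd\<close>.\<close>
  have K: "(\<Sum>k\<in>UNIV. riemann_mixed i a b k x * u x $ k) = 0" for i a b
    using partial_commute[OF assms(1) u, of a b i] unfolding dd riemann_mixed_def
    by (simp add: left_diff_distrib distrib_right sum.distrib sum_subtractf)
  have R: "(\<Sum>c\<in>UNIV. riemann \<phi> g a b c d x * u x $ c) = 0" for a b d
  proof -
    have "(\<Sum>c\<in>UNIV. riemann \<phi> g a b c d x * u x $ c)
        = (\<Sum>i\<in>UNIV. g x $ d $ i * (\<Sum>c\<in>UNIV. riemann_mixed i a b c x * u x $ c))"
      unfolding riemann_eq sum_distrib_left sum_distrib_right
      by (subst sum.swap) (simp add: mult.assoc)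
    then show ?thesis by (simp add: K)
  qed
  have "(\<Sum>c\<in>UNIV. ricci \<phi> g b c x * u x $ c)
      = (\<Sum>a\<in>UNIV. \<Sum>d\<in>UNIV. ginv g a d x * (\<Sum>c\<in>UNIV. riemann \<phi> g a b c d x * u x $ c))"
    unfolding ricci_def sum_distrib_left sum_distrib_right
    by (subst sum.swap, rule sum.cong[OF refl], subst sum.swap) (simp add: mult.assoc)
  then show ?thesis by (simp add: R)
qed

end

text \<open>The field equations enter solved for the Ricci tensor, with the gravitational constant
  absorbed in \<open>\<alpha>\<close> and \<open>\<beta>\<close>;
  \<open>ricci_of_einstein_equations\<close> supplies this form.\<close>

locale fluid_chart = chart_metric \<phi> g
  for \<phi> :: "('m::topological_space, 4) chart" and g :: "'m \<Rightarrow> real^4^4" +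
  fixes u :: "'m \<Rightarrow> real^4" and \<alpha> \<beta> :: "'m \<Rightarrow> real"
  assumes u_smooth: "smooth_in_chart \<phi> (\<lambda>x. u x $ a)"
    and \<alpha>_smooth: "smooth_in_chart \<phi> \<alpha>" and \<beta>_smooth: "smooth_in_chart \<phi> \<beta>"
    and unit: "x \<in> U \<Longrightarrow> (\<Sum>a\<in>UNIV. lower g u x $ a * u x $ a) = -1"
    and ricci_fluid: "x \<in> U \<Longrightarrow> ricci \<phi> g a b x
      = \<alpha> x * (lower g u x $ a * lower g u x $ b) + \<beta> x * g x $ a $ b"
    and W_conserved_chart: "x \<in> U \<Longrightarrow> div13 (W_up \<phi> g) b c d x = 0"
begin

abbreviation w :: "4 \<Rightarrow> 'm \<Rightarrow> real" where "w a \<equiv> \<lambda>x. lower g u x $ a"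
abbreviation dw :: "4 \<Rightarrow> 4 \<Rightarrow> 'm \<Rightarrow> real" where "dw \<equiv> cov_low \<phi> g (lower g u)"

lemma w_smooth: "smooth_in_chart \<phi> (w a)"
  by (rule lower_smooth[OF u_smooth])

lemma sum_g_u: "x \<in> U \<Longrightarrow> (\<Sum>d\<in>UNIV. u x $ d * g x $ b $ d) = w b x"
  by (simp add: lower_def matrix_vector_mult_def mult.commute)

text \<open>Raising \<open>a\<close> turns g_ac into a Kronecker delta and R_ad into R^h_d, the two
  shapes treated by \<open>div13_delta_left\<close> and \<open>div13_metric_left\<close>.\<close>

lemma W_up_eq:
  assumes "x \<in> U"
  shows "W_up \<phi> g h b c d x = (\<Sum>a\<in>UNIV. ginv g h a x * riemann \<phi> g a b c d x)
     + (1/3) * ((if h = c then ricci \<phi> g b d x else 0) - g x $ b $ c * ricci_mixed h d x)"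
proof -
  have "(\<Sum>a\<in>UNIV. ginv g h a x * (g x $ a $ c * ricci \<phi> g b d x)) = (if h = c then ricci \<phi> g b d x else 0)"
    using ginv_left[OF assms, of h c] by (simp add: mult.assoc[symmetric] sum_distrib_right[symmetric])
  moreover have "W_up \<phi> g h b c d x = (\<Sum>a\<in>UNIV. ginv g h a x * riemann \<phi> g a b c d x)
     + (1/3) * ((\<Sum>a\<in>UNIV. ginv g h a x * (g x $ a $ c * ricci \<phi> g b d x)) - g x $ b $ c * ricci_mixed h d x)"
    unfolding W_up_def W_low_def ricci_mixed_def sum_distrib_left sum_subtractf[symmetric] sum.distrib[symmetric]
    by (simp add: algebra_simps)
  ultimately show ?thesis by simp
qed

lemma W_up_smooth: "smooth_in_chart \<phi> (W_up \<phi> g h b c d)"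
  unfolding W_up_def[abs_def] W_low_def
  by (auto intro!: smooth_intros ginv_smooth riemann_smooth ricci_smooth metric_smooth)

text \<open>
  The Riemann part of the tensor drops out of the divergence when it is symmetrized in its last two
  indices, so that the second Bianchi identity is not needed.
\<close>

lemma cov_ricci_symmetrized:
  assumes "x \<in> U"
  shows "cov2 (ricci \<phi> g) c b d x + cov2 (ricci \<phi> g) d b c x
     = g x $ b $ c * div11 ricci_mixed d x + g x $ b $ d * div11 ricci_mixed c x"
proof -
  \<comment> \<open>\<open>E\<close> and \<open>F\<close> are the two Ricci parts of the W-tensor,
    without the factor 1/3 and the sign.\<close>
  define E where "E h b c d y = (if h = c then ricci \<phi> g b d y else 0)" for h b c d :: 4 and y
  define F where "F h b c d y = g y $ b $ c * ricci_mixed h d y" for h b c d :: 4 and y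
  have E: "smooth_in_chart \<phi> (E h b c d)" for h b c d
    unfolding E_def[abs_def] by (intro smooth_if smooth_const ricci_smooth)
  have F: "smooth_in_chart \<phi> (F h b c d)" for h b c d
    unfolding F_def[abs_def] by (intro smooth_mult metric_smooth ricci_mixed_smooth)
  have W: "smooth_in_chart \<phi> (W_up \<phi> g h b c d)" for h b c d
    by (rule W_up_smooth)
  have eq: "W_up \<phi> g h b c d y + W_up \<phi> g h b d c y
      = (1/3) * ((E h b c d y + E h b d c y) + (-1) * (F h b c d y + F h b d c y))"
    if "y \<in> U" for h b c d y
  proof -
    have "(\<Sum>a\<in>UNIV. ginv g h a y * riemann \<phi> g a b c d y) = - (\<Sum>a\<in>UNIV. ginv g h a y * riemann \<phi> g a b d c y)"
      by (simp add: riemann_antisym_last[OF that, of _ b c d] sum_negf)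
    then show ?thesis by (simp add: W_up_eq[OF that] E_def F_def algebra_simps)
  qed
  have "0 = div13 (\<lambda>h b c d y. W_up \<phi> g h b c d y + W_up \<phi> g h b d c y) b c d x"
    by (simp add: div13_add[OF assms W W] div13_swap[of "W_up \<phi> g"] W_conserved_chart[OF assms])
  also have "\<dots> = div13 (\<lambda>h b c d y. (1/3) * ((E h b c d y + E h b d c y)
      + (-1) * (F h b c d y + F h b d c y))) b c d x"
    by (rule div13_cong[OF assms smooth_add[OF W W] eq])
  also have "\<dots> = (1/3) * ((div13 E b c d x + div13 E b d c x) + (-1) * (div13 F b c d x + div13 F b d c x))"
    by (simp only: div13_cmult[OF assms] div13_add[OF assms] smooth_add smooth_mult smooth_const E F
        div13_swap[of E] div13_swap[of F])
  finally have "div13 E b c d x + div13 E b d c x = div13 F b c d x + div13 F b d c x"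
    by simp
  then show ?thesis
    unfolding E_def[abs_def] F_def[abs_def]
    by (simp only: div13_delta_left div13_metric_left[OF assms ricci_mixed_smooth])
qed

text \<open>The combination known from the Koszul formula: the instances (c,b,d) and (b,d,c) minus
  (b,c,d). Symmetry in the last two indices, read off from the fluid form of the Ricci tensor,
  leaves twice the claim.\<close>

lemma cov_ricci:
  assumes "x \<in> U"
  shows "cov2 (ricci \<phi> g) c b d x = g x $ b $ d * div11 ricci_mixed c x"
proof -
  have rs: "ricci \<phi> g a b y = ricci \<phi> g b a y" if "y \<in> U" for y a b
    by (simp add: ricci_fluid[OF that] g_sym[OF that, of a b])
  have sym: "cov2 (ricci \<phi> g) c b d x = cov2 (ricci \<phi> g) c d b x" for c b d
  proof -
    have "partial \<phi> c (ricci \<phi> g b d) x = partial \<phi> c (ricci \<phi> g d b) x"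
      by (rule partial_smooth_cong[OF assms ricci_smooth rs])
    then show ?thesis
      by (simp add: cov2_def rs[OF assms, of _ d] rs[OF assms, of b])
  qed
  show ?thesis
    using cov_ricci_symmetrized[OF assms, of c b d] cov_ricci_symmetrized[OF assms, of b c d]
      cov_ricci_symmetrized[OF assms, of b d c] sym[of b c d] sym[of c b d] sym[of d b c]
    unfolding g_sym[OF assms, of c b] g_sym[OF assms, of d b] g_sym[OF assms, of d c]
    by linarith
qed

text \<open>The connection terms complete the derivatives of \<open>w\<close> to \<open>dw\<close>,
  and those of the metric cancel its derivative by \<open>metric_parallel\<close>.\<close>

lemma cov_ricci_fluid:
  assumes "x \<in> U"
  shows "cov2 (ricci \<phi> g) c b d x = partial \<phi> c \<alpha> x * (w b x * w d x)
     + \<alpha> x * (dw c b x * w d x + w b x * dw c d x) + partial \<phi> c \<beta> x * g x $ b $ d"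
proof -
  have "partial \<phi> c (ricci \<phi> g b d) x = partial \<phi> c (\<lambda>y. \<alpha> y * (w b y * w d y) + \<beta> y * g y $ b $ d) x"
    by (rule partial_smooth_cong[OF assms ricci_smooth ricci_fluid])
  also have "\<dots> = partial \<phi> c \<alpha> x * (w b x * w d x)
      + \<alpha> x * (partial \<phi> c (w b) x * w d x + w b x * partial \<phi> c (w d) x)
      + partial \<phi> c \<beta> x * g x $ b $ d + \<beta> x * partial \<phi> c (\<lambda>y. g y $ b $ d) x"
    by (simp add: partial_add[OF assms] partial_mult[OF assms] smooth_mult \<alpha>_smooth \<beta>_smooth w_smooth
        metric_smooth)
  finally have p: "partial \<phi> c (ricci \<phi> g b d) x = \<dots>" .
  have q: "(\<Sum>f\<in>UNIV. \<Gamma> f c b x * ricci \<phi> g f d x)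
      = \<alpha> x * ((\<Sum>f\<in>UNIV. \<Gamma> f c b x * w f x) * w d x) + \<beta> x * (\<Sum>f\<in>UNIV. \<Gamma> f c b x * g x $ f $ d)" for b d
    by (simp add: ricci_fluid[OF assms] distrib_left sum.distrib sum_distrib_left sum_distrib_right mult_ac)
  have r: "(\<Sum>f\<in>UNIV. \<Gamma> f c d x * ricci \<phi> g b f x) = (\<Sum>f\<in>UNIV. \<Gamma> f c d x * ricci \<phi> g f b x)"
    by (simp add: ricci_fluid[OF assms] g_sym[OF assms, of b] mult.commute)
  show ?thesis
    unfolding cov2_def p q r metric_parallel[OF assms] cov_low_def
    by (simp add: algebra_simps)
qed

lemma fluid_parallel:
  assumes "x \<in> U"
  shows "partial \<phi> c \<alpha> x = 0" "\<alpha> x * dw c b x = 0"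
proof -
  let ?D = "div11 ricci_mixed c x" and ?a = "partial \<phi> c \<alpha> x" and ?b = "partial \<phi> c \<beta> x"
  have eq: "?a * (w b x * w d x) + \<alpha> x * (dw c b x * w d x + w b x * dw c d x) + ?b * g x $ b $ d
      = g x $ b $ d * ?D" for b d
    using cov_ricci_fluid[OF assms] cov_ricci[OF assms] by simp
  have uw: "(\<Sum>d\<in>UNIV. u x $ d * w d x) = -1" using unit[OF assms] by (simp add: mult.commute)
  have ud: "(\<Sum>d\<in>UNIV. u x $ d * dw c d x) = 0"
    by (rule unit_cov_low[OF assms u_smooth unit])
  have ug: "(\<Sum>d\<in>UNIV. u x $ d * g x $ b $ d) = w b x" for b by (rule sum_g_u[OF assms])
  \<comment> \<open>Contraction of \<open>eq\<close> with \<open>u\<close>, where \<open>u\<close>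
    paired with \<open>w\<close> gives -1 and paired with \<open>dw\<close> gives 0.\<close>
  have eq1: "- ?a * w b x - \<alpha> x * dw c b x + ?b * w b x = w b x * ?D" for b
  proof -
    have "(\<Sum>d\<in>UNIV. u x $ d * (?a * (w b x * w d x) + \<alpha> x * (dw c b x * w d x + w b x * dw c d x) + ?b * g x $ b $ d))
        = ?a * w b x * (\<Sum>d\<in>UNIV. u x $ d * w d x) + \<alpha> x * dw c b x * (\<Sum>d\<in>UNIV. u x $ d * w d x)
          + \<alpha> x * w b x * (\<Sum>d\<in>UNIV. u x $ d * dw c d x) + ?b * (\<Sum>d\<in>UNIV. u x $ d * g x $ b $ d)"
      by (simp add: sum_distrib_left sum.distrib distrib_left mult_ac)
    moreover have "(\<Sum>d\<in>UNIV. u x $ d * (g x $ b $ d * ?D)) = (\<Sum>d\<in>UNIV. u x $ d * g x $ b $ d) * ?D"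
      by (simp add: sum_distrib_right mult.assoc)
    ultimately show ?thesis unfolding eq uw ud ug by simp
  qed
  \<comment> \<open>A second contraction with \<open>u\<close> determines the divergence of the
    Ricci tensor.\<close>
  have D: "?D = ?b - ?a"
  proof -
    have "(\<Sum>d\<in>UNIV. u x $ d * (- ?a * w d x - \<alpha> x * dw c d x + ?b * w d x))
        = - ?a * (\<Sum>d\<in>UNIV. u x $ d * w d x) - \<alpha> x * (\<Sum>d\<in>UNIV. u x $ d * dw c d x) + ?b * (\<Sum>d\<in>UNIV. u x $ d * w d x)"
      by (simp add: sum_distrib_left sum.distrib sum_subtractf sum_negf distrib_left right_diff_distrib mult_ac)
    moreover have "(\<Sum>d\<in>UNIV. u x $ d * (w d x * ?D)) = (\<Sum>d\<in>UNIV. u x $ d * w d x) * ?D"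
      by (simp add: sum_distrib_right mult.assoc)
    ultimately show ?thesis unfolding eq1 uw ud by simp
  qed
  \<comment> \<open>After this value is inserted, all other terms of \<open>eq1\<close>
    cancel.\<close>
  show z: "\<alpha> x * dw c b x = 0" for b using eq1[of b] by (simp add: D algebra_simps)
  \<comment> \<open>What is left of \<open>eq\<close> is \<open>?a\<close> times the projector h_bd,
    whose trace is -1 + 4 = 3.\<close>
  have "?a * (w b x * w d x) + ?a * g x $ b $ d = 0" for b d
    using eq[of b d] z[of b] z[of d] by (auto simp: D algebra_simps)
  then have "0 = (\<Sum>b\<in>UNIV. \<Sum>d\<in>UNIV. ginv g b d x * (?a * (w b x * w d x) + ?a * g x $ b $ d))"
    by simp
  also have "\<dots> = ?a * (\<Sum>b\<in>UNIV. w b x * (\<Sum>d\<in>UNIV. ginv g b d x * w d x))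
      + ?a * (\<Sum>b\<in>UNIV. \<Sum>d\<in>UNIV. ginv g b d x * g x $ b $ d)"
    by (simp add: sum_distrib_left sum.distrib distrib_left mult_ac)
  also have "\<dots> = 3 * ?a"
    by (simp add: ginv_lower[OF assms] unit[OF assms] sum_ginv_g[OF assms])
  finally show "?a = 0" by simp
qed

end

text \<open>For vanishing \<open>\<alpha>\<close> this identifies \<open>\<beta>\<close> with a
  quarter of the scalar curvature, which is the Einstein condition.\<close>

lemma (in fluid_chart) scalar_curvature_fluid:
  assumes "x \<in> U"
  shows "scalar_curvature \<phi> g x = 4 * \<beta> x - \<alpha> x"
proof -
  have "scalar_curvature \<phi> g x = \<alpha> x * (\<Sum>b\<in>UNIV. w b x * (\<Sum>c\<in>UNIV. ginv g b c x * w c x))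
      + \<beta> x * (\<Sum>b\<in>UNIV. \<Sum>c\<in>UNIV. ginv g b c x * g x $ b $ c)"
    by (simp add: scalar_curvature_def ricci_fluid[OF assms] sum_distrib_left sum.distrib distrib_left mult_ac)
  then show ?thesis
    by (simp add: ginv_lower[OF assms] unit[OF assms] sum_ginv_g[OF assms])
qed

text \<open>Contracting the Ricci tensor with \<open>u\<close> gives
  \<open>\<beta> - \<alpha>\<close> times \<open>w\<close> by the fluid form and zero by
  \<open>ricci_parallel_vector\<close>; the unit norm keeps \<open>w\<close> from vanishing.\<close>

lemma (in fluid_chart) parallel_imp_equal:
  assumes "x \<in> U" and par: "\<And>y a b. y \<in> U \<Longrightarrow> dw b a y = 0"
  shows "\<alpha> x = \<beta> x"
proof -
  have "cov_up \<phi> g u b a y = 0" if "y \<in> U" for y a b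
    by (simp add: cov_up_eq_cov_low[OF that u_smooth] par[OF that])
  then have 0: "(\<Sum>c\<in>UNIV. ricci \<phi> g b c x * u x $ c) = 0" for b
    by (rule ricci_parallel_vector[OF assms(1) u_smooth])
  have eq: "(\<Sum>c\<in>UNIV. ricci \<phi> g b c x * u x $ c)
      = \<alpha> x * w b x * (\<Sum>c\<in>UNIV. w c x * u x $ c) + \<beta> x * (\<Sum>c\<in>UNIV. u x $ c * g x $ b $ c)" for b
    by (simp add: ricci_fluid[OF assms(1)] sum_distrib_left sum.distrib distrib_left distrib_right mult_ac)
  have 1: "(\<beta> x - \<alpha> x) * w b x = 0" for b
    using 0[of b] unfolding eq unit[OF assms(1)] sum_g_u[OF assms(1)] by (simp add: algebra_simps)
  have "\<exists>b. w b x \<noteq> 0"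
    using unit[OF assms(1)] by (metis (no_types, lifting) mult_zero_left sum.neutral zero_neq_neg_one)
  then show ?thesis using 1 by (metis eq_iff_diff_eq_0 mult_eq_0_iff)
qed

text \<open>The trace comes first: the scalar curvature occurs on both sides of it, in dimension 4
  with coefficients 1 and 2, and can be solved for as \<open>k (\<mu> - 3 p)\<close>.\<close>

lemma (in chart_metric) ricci_of_einstein_equations:
  assumes "x \<in> U" "CARD('n) = 4"
    and unit: "(\<Sum>a\<in>UNIV. lower g u x $ a * u x $ a) = -1"
    and eq: "\<And>a b. ricci \<phi> g a b x - 1/2 * scalar_curvature \<phi> g x * g x $ a $ b
       = k * perfect_fluid_tensor g u \<mu> p a b x"
  shows "ricci \<phi> g a b x = k * (\<mu> x + p x) * (lower g u x $ a * lower g u x $ b)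
     + k * (\<mu> x - p x) / 2 * g x $ a $ b"
proof -
  let ?w = "\<lambda>a. lower g u x $ a" and ?R = "scalar_curvature \<phi> g x"
  have r: "ricci \<phi> g a b x = k * (\<mu> x + p x) * (?w a * ?w b) + (k * p x + ?R / 2) * g x $ a $ b" for a b
    using eq[of a b] by (simp add: perfect_fluid_tensor_def algebra_simps)
  have "?R = k * (\<mu> x + p x) * (\<Sum>b\<in>UNIV. ?w b * (\<Sum>c\<in>UNIV. ginv g b c x * ?w c))
      + (k * p x + ?R / 2) * (\<Sum>b\<in>UNIV. \<Sum>c\<in>UNIV. ginv g b c x * g x $ b $ c)"
    by (subst scalar_curvature_def, unfold r)
      (simp add: sum_distrib_left sum.distrib distrib_left mult_ac)
  then have "?R = - k * (\<mu> x + p x) + (k * p x + ?R / 2) * 4"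
    by (simp add: ginv_lower[OF assms(1)] unit sum_ginv_g[OF assms(1)] assms(2))
  then have R: "?R = k * (\<mu> x - 3 * p x)" by (simp add: algebra_simps)
  have "k * p x + ?R / 2 = k * (\<mu> x - p x) / 2" by (simp add: R field_simps)
  then show ?thesis by (simp only: r)
qed

section \<open>From single charts to the whole spacetime\<close>

lemma lorentz_form_invertible:
  assumes "lorentz_form B"
  shows "invertible B"
proof -
  obtain P where P: "transpose P ** B ** P = minkowski" using assms by (auto simp: lorentz_form_def)
  have "det minkowski = (\<Prod>i\<in>UNIV. minkowski $ i $ i)"
    by (rule det_diagonal) (simp add: minkowski_def)
  also have "\<dots> \<noteq> 0" by (simp add: minkowski_def)
  finally have "det (transpose P ** B ** P) \<noteq> 0" by (simp add: P)
  then show ?thesis by (simp add: det_mul invertible_det_nz)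
qed

lemma smooth_atlas_covers: "smooth_atlas A \<Longrightarrow> \<exists>\<phi>\<in>A. x \<in> chart_dom \<phi>"
  unfolding smooth_atlas_def by (metis UN_iff UNIV_I)

text \<open>Each chart gives local constancy, which connectedness makes global.\<close>

lemma smooth_in_charts_partial_zero_imp_constant:
  fixes f :: "'m::topological_space \<Rightarrow> real"
  assumes "smooth_atlas A" "connected (UNIV :: 'm set)" "scalar_field A f"
    and "\<And>\<phi> x i. \<phi> \<in> A \<Longrightarrow> x \<in> chart_dom \<phi> \<Longrightarrow> partial \<phi> i f x = 0"
  shows "\<exists>C. \<forall>x. f x = C"
proof -
  have "eventually (\<lambda>b. f a = f b) (at a)" for a
  proof -
    obtain \<phi> where \<phi>: "\<phi> \<in> A" "a \<in> chart_dom \<phi>" using smooth_atlas_covers[OF assms(1)] by blast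
    interpret local_chart \<phi> using assms(1) \<phi>(1) by unfold_locales (auto simp: smooth_atlas_def)
    have "smooth_in_chart \<phi> f" using assms(3) \<phi>(1) by (simp add: scalar_field_def)
    from partial_zero_imp_locally_constant[OF \<phi>(2) this] assms(4)[OF \<phi>(1)]
    obtain N where "open N" "a \<in> N" "\<forall>y\<in>N. f y = f a" by blast
    then show ?thesis unfolding eventually_at_topological by metis
  qed
  then have "f a = f b" for a b
    by (intro connected_local_const[OF assms(2)]) auto
  then show ?thesis by blast
qed

theorem theorem4p8:
  fixes A :: "('m::{t2_space, second_countable_topology}, 4) chart set"
    and g :: "('m, 4) chart \<Rightarrow> 'm \<Rightarrow> real^4^4"
    and u :: "('m, 4) chart \<Rightarrow> 'm \<Rightarrow> real^4"
    and \<mu> p :: "'m \<Rightarrow> real"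
    and k :: real
  assumes "spacetime A g"
    and "scalar_field A \<mu>" and "scalar_field A p"
    and "vector_field A u" and "unit_timelike A g u"
    and "k \<noteq> 0"
    and "einstein_equations A g k (\<lambda>\<phi>. perfect_fluid_tensor (g \<phi>) (u \<phi>) \<mu> p)"
    and "W_conserved A g"
  shows "(einstein_spacetime A g \<and> (\<forall>x. \<mu> x + p x = 0)) \<or>
         (FRW_model A g u \<mu> p \<and> (\<exists>C. \<forall>x. \<mu> x - 3 * p x = C))"
proof -
  have atlas: "smooth_atlas A" and conn: "connected (UNIV :: 'm set)" and metric: "lorentz_metric A g"
    using assms(1) by (auto simp: spacetime_def)
  define \<alpha> where "\<alpha> x = k * (\<mu> x + p x)" for x
  define \<beta> where "\<beta> x = k * (\<mu> x - p x) / 2" for x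
  have lc: "local_chart \<phi>" if "\<phi> \<in> A" for \<phi>
    using atlas that by unfold_locales (auto simp: smooth_atlas_def)
  have cm: "chart_metric \<phi> (g \<phi>)" if \<phi>: "\<phi> \<in> A" for \<phi>
  proof -
    interpret local_chart \<phi> by (rule lc[OF \<phi>])
    show ?thesis
    proof unfold_locales
      fix y assume "y \<in> U"
      then have "lorentz_form (g \<phi> y)" using metric \<phi> by (simp add: lorentz_metric_def)
      then show "transpose (g \<phi> y) = g \<phi> y" "invertible (g \<phi> y)"
        by (simp add: lorentz_form_def, rule lorentz_form_invertible)
    next
      show "smooth_in_chart \<phi> (\<lambda>y. g \<phi> y $ i $ j)" for i j
        using metric \<phi> by (simp add: lorentz_metric_def bilinear_form_field_def)
    qed
  qed
  have fc: "fluid_chart \<phi> (g \<phi>) (u \<phi>) \<alpha> \<beta>" if \<phi>: "\<phi> \<in> A" for \<phi>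
  proof -
    interpret chart_metric \<phi> "g \<phi>" by (rule cm[OF \<phi>])
    have sm: "smooth_in_chart \<phi> \<mu>" "smooth_in_chart \<phi> p"
      using assms(2,3) \<phi> by (auto simp: scalar_field_def)
    show ?thesis
    proof unfold_locales
      show "smooth_in_chart \<phi> (\<lambda>x. u \<phi> x $ a)" for a
        using assms(4) \<phi> by (simp add: vector_field_def)
      show "smooth_in_chart \<phi> \<alpha>" "smooth_in_chart \<phi> \<beta>"
        unfolding \<alpha>_def[abs_def] \<beta>_def[abs_def] by (intro smooth_intros sm)+
      fix x assume x: "x \<in> U"
      show unit: "(\<Sum>a\<in>UNIV. lower (g \<phi>) (u \<phi>) x $ a * u \<phi> x $ a) = -1"
        using assms(5) \<phi> x by (simp add: unit_timelike_def)
      show "ricci \<phi> (g \<phi>) a b x = \<alpha> x * (lower (g \<phi>) (u \<phi>) x $ a * lower (g \<phi>) (u \<phi>) x $ b)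
          + \<beta> x * g \<phi> x $ a $ b" for a b
        unfolding \<alpha>_def \<beta>_def
        by (rule ricci_of_einstein_equations[OF x _ unit])
          (use assms(7) \<phi> x in \<open>auto simp: einstein_equations_def\<close>)
      show "div13 (W_up \<phi> (g \<phi>)) b c d x = 0" for b c d
        using assms(8) \<phi> x by (simp add: W_conserved_def div13_def)
    qed
  qed
  \<comment> \<open>\<open>\<alpha>\<close> is a function on the manifold itself, so the results in
    the individual charts fit together.\<close>
  have "scalar_field A \<alpha>"
    using fluid_chart.\<alpha>_smooth[OF fc] by (simp add: scalar_field_def)
  then have "\<exists>C. \<forall>x. \<alpha> x = C"
    by (rule smooth_in_charts_partial_zero_imp_constant[OF atlas conn])
      (rule fluid_chart.fluid_parallel(1)[OF fc])
  then obtain C where C: "\<alpha> x = C" for x by blast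
  \<comment> \<open>Constancy of \<open>\<alpha>\<close> makes the alternative global:
    \<open>\<mu> + p\<close> vanishes either everywhere or nowhere.\<close>
  show ?thesis
  proof (cases "C = 0")
    case True
    have "ricci \<phi> (g \<phi>) a b x = scalar_curvature \<phi> (g \<phi>) x / 4 * g \<phi> x $ a $ b"
      if "\<phi> \<in> A" "x \<in> chart_dom \<phi>" for \<phi> x a b
      using fluid_chart.scalar_curvature_fluid[OF fc[OF that(1)] that(2)]
        fluid_chart.ricci_fluid[OF fc[OF that(1)] that(2), of a b]
      by (simp add: C True)
    moreover have "\<mu> x + p x = 0" for x
      using C[of x] True assms(6) by (simp add: \<alpha>_def)
    ultimately show ?thesis by (simp add: einstein_spacetime_def)
  next
    case False
    have par: "cov_low \<phi> (g \<phi>) (lower (g \<phi>) (u \<phi>)) b a x = 0"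
      if "\<phi> \<in> A" "x \<in> chart_dom \<phi>" for \<phi> x a b
      using fluid_chart.fluid_parallel(2)[OF fc[OF that(1)] that(2), of b a] False by (simp add: C)
    have up: "cov_up \<phi> (g \<phi>) (u \<phi>) b a x = 0" if "\<phi> \<in> A" "x \<in> chart_dom \<phi>" for \<phi> x a b
      unfolding chart_metric.cov_up_eq_cov_low[OF cm[OF that(1)] that(2) fluid_chart.u_smooth[OF fc[OF that(1)]]]
      by (simp add: par[OF that])
    \<comment> \<open>The equality of \<open>\<alpha>\<close> and \<open>\<beta>\<close> means
      \<open>\<mu> - p = 2 C / k\<close>, while \<open>\<mu> + p = C / k\<close>. In particular
      \<open>\<mu> + 3 p = 0\<close>, as in the Einstein static universe.\<close>
    have "\<mu> x = 3 / 2 * (C / k) \<and> p x = - 1 / 2 * (C / k)" for x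
    proof -
      obtain \<phi> where \<phi>: "\<phi> \<in> A" "x \<in> chart_dom \<phi>" using smooth_atlas_covers[OF atlas] by blast
      have "\<alpha> x = \<beta> x"
        by (rule fluid_chart.parallel_imp_equal[OF fc[OF \<phi>(1)] \<phi>(2) par[OF \<phi>(1)]])
      then have "k * (\<mu> x + p x) = C" "k * (\<mu> x - p x) / 2 = C"
        using C[of x] unfolding \<alpha>_def \<beta>_def by simp_all
      then have "\<mu> x + p x = C / k" "\<mu> x - p x = 2 * (C / k)"
        using assms(6) by (auto simp: field_simps)
      then show ?thesis by simp
    qed
    then have \<mu>p: "\<mu> = (\<lambda>_. 3 / 2 * (C / k))" "p = (\<lambda>_. - 1 / 2 * (C / k))" by auto
    have const: "partial \<phi> b (\<lambda>_. c) x = 0" if "\<phi> \<in> A" for \<phi> b c x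
      by (rule local_chart.partial_const[OF lc[OF that]])
    \<comment> \<open>All kinematical quantities are linear in the derivative of \<open>u\<close>,
      which vanishes; \<open>up\<close> serves the expansion inside the shear.\<close>
    have "FRW_model A g u \<mu> p"
      unfolding FRW_model_def acceleration_def shear_def rotation_def expansion_def \<mu>p
      using False assms(6) by (simp add: par up const)
    then show ?thesis by (auto simp: \<mu>p)
  qed
qed

end
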